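(* Suppose that for every policy in $\Pi_1$ the induced state covariance satisfies $\Sigma_k\in\mathbb{S}_n^{++}$ for all $k\in\{0,\dots,N\}$. Assume that $A_k$ is non-singular for all $k\in\{0,\dots,N-1\}$. Let $\pi'\in\Pi_2$ be an optimal policy, i.e. one whose parameters $\{v_k,K_k,Q_k\}_{k=0}^{N-1}$ (together with the induced state means and covariances) solve the problem (NLP) defined in the context. Then $Q_k=0$ for all $k\in\{0,\dots,N-1\}$.
   Context: $\mathbb{S}_n^{+}$ and $\mathbb{S}_n^{++}$ denote the real symmetric positive semidefinite and positive definite $n\times n$ matrices. Data: $N\in\mathbb{Z}^+$, $\lambda>0$, $\mu_0,\mu_{\mathrm d}\in\mathbb{R}^n$, $\Sigma_0,\Sigma_{\mathrm d}\in\mathbb{S}_n^{++}$, and for $k=0,\dots,N-1$: $A_k\in\mathbb{R}^{n\times n}$, $B_k\in\mathbb{R}^{n\times m}$, $W_k\in\mathbb{S}_n^{+}$, $R_k\in\mathbb{S}_m^{++}$. System: $x_{k+1}=A_kx_k+B_ku_k+w_k$, $k=0,\dots,N-1$, with $x_0\sim\mathcal N(\mu_0,\Sigma_0)$ and $w_k\sim\mathcal N(0,W_k)$, all independent. $\Pi_1$ (state history feedback, used only in the hypothesis): policies $u_k=v_k+\sum_{\tau=0}^{k}K_{k,\tau}(x_\tau-\mathbb{E}[x_\tau])$ with arbitrary $v_k\in\mathbb{R}^m$, $K_{k,\tau}\in\mathbb{R}^{m\times n}$; in the hypothesis $\Sigma_k$ denotes the covariance of $x_k$ under such a policy. $\Pi_2$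 (randomized state feedback): policies $u_k=v_k+K_k(x_k-\mathbb{E}[x_k])+n_k$ with parameters $v_k\in\mathbb{R}^m$, $K_k\in\mathbb{R}^{m\times n}$, $Q_k\in\mathbb{S}_m^{+}$, where $n_k\sim\mathcal N(0,Q_k)$ and the $n_k$ are mutually independent and independent of $x_0,w_0,\dots,w_{N-1}$. Problem (NLP): minimize over $v_k\in\mathbb{R}^m$, $K_k\in\mathbb{R}^{m\times n}$, $Q_k\in\mathbb{S}_m^{+}$ ($0\le k\le N-1$) and $\mu_k\in\mathbb{R}^n$, $\Sigma_k\in\mathbb{S}_n^{+}$ ($0\le k\le N$, with $\mu_0,\Sigma_0$ fixed to the given data) the objective $$\sum_{k=0}^{N-1}\Big(v_k^{\mathrm T}R_kv_k+\operatorname{tr}\big(R_k(K_k\Sigma_kK_k^{\mathrm T}+Q_k)\big)\Big)+\lambda\Big(\|\mu_N-\mu_{\mathrm d}\|_2^2+\operatorname{tr}(\Sigma_N+\Sigma_{\mathrm d})-2\operatorname{tr}\big((\sqrt{\Sigma_{\mathrm d}}\,\Sigma_N\sqrt{\Sigma_{\mathrm d}})^{1/2}\big)\Big)$$ subject to, for $k=0,\dots,N-1$, $$\mu_{k+1}=A_k\mu_k+B_kv_k,\qquad \Sigma_{k+1}=(A_k+B_kK_k)\Sigma_k(A_k+B_kK_k)^{\mathrm T}+B_kQ_kB_k^{\mathrm T}+W_k.$$ *)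

theory Defs
  imports "HOL-Probability.Probability"
begin

section \<open>Symmetric (semi)definite matrices\<close>

definition psd :: "real^'n^'n \<Rightarrow> bool" where
  "psd S \<longleftrightarrow> transpose S = S \<and> (\<forall>x. 0 \<le> x \<bullet> (S *v x))"

definition pd :: "real^'n^'n \<Rightarrow> bool" where
  "pd S \<longleftrightarrow> transpose S = S \<and> (\<forall>x. x \<noteq> 0 \<longrightarrow> 0 < x \<bullet> (S *v x))"

text \<open>Meaningful for positive semidefinite arguments only, for which the positive semidefinite
  square root exists and is unique.\<close>

definition psd_sqrt :: "real^'n^'n \<Rightarrow> real^'n^'n" where
  "psd_sqrt S = (THE T. psd T \<and> T ** T = S)"


section \<open>Gaussian random vectors, covariance matrices, independence\<close>

text \<open>The univariate normal law with mean \<open>m\<close> and variance \<open>s\<close>; for variance \<open>0\<close> it is the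
  point mass at \<open>m\<close>.\<close>

definition normal_law :: "real \<Rightarrow> real \<Rightarrow> real measure" where
  "normal_law m s =
     (if s = 0 then return borel m else density lborel (\<lambda>x. ennreal (normal_density m (sqrt s) x)))"

text \<open>A random vector is Gaussian if all its one-dimensional projections are; the covariance
  matrix \<open>S\<close> may be singular.\<close>

definition gaussian_vector ::
    "'a measure \<Rightarrow> real^'n \<Rightarrow> real^'n^'n \<Rightarrow> ('a \<Rightarrow> real^'n) \<Rightarrow> bool" where
  "gaussian_vector M m S X \<longleftrightarrow>
     X \<in> borel_measurable M \<and>
     (\<forall>a. distr M borel (\<lambda>\<omega>. a \<bullet> X \<omega>) = normal_law (a \<bullet> m) (a \<bullet> (S *v a)))"

definition mean :: "'a measure \<Rightarrow> ('a \<Rightarrow> real^'n) \<Rightarrow> real^'n" where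
  "mean M X = (\<integral>\<omega>. X \<omega> \<partial>M)"

definition cov :: "'a measure \<Rightarrow> ('a \<Rightarrow> real^'n) \<Rightarrow> real^'n^'n" where
  "cov M X = (\<chi> i j. \<integral>\<omega>. (X \<omega> $ i - mean M X $ i) * (X \<omega> $ j - mean M X $ j) \<partial>M)"

definition rv_events :: "'a measure \<Rightarrow> ('a \<Rightarrow> 'b::topological_space) \<Rightarrow> 'a set set" where
  "rv_events M X = {X -` S \<inter> space M | S. S \<in> sets borel}"

text \<open>The control noise takes values in another space than the initial state and the disturbances,
  so \<open>prob_space.indep_vars\<close>, which has a single value type, does not apply; joint independence
  is stated through the generated sigma-algebras instead.\<close>

datatype source = Init | Disturbance nat | Control nat

definition independent_sources ::
    "'a measure \<Rightarrow> nat \<Rightarrow> ('a \<Rightarrow> real^'n) \<Rightarrow> (nat \<Rightarrow> 'a \<Rightarrow> real^'n) \<Rightarrow> (nat \<Rightarrow> 'a \<Rightarrow> real^'m) \<Rightarrow> bool"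
where
  "independent_sources M N x0 w \<nu> \<longleftrightarrow>
     prob_space.indep_sets M
       (\<lambda>i. case i of Init \<Rightarrow> rv_events M x0
                    | Disturbance k \<Rightarrow> rv_events M (w k)
                    | Control k \<Rightarrow> rv_events M (\<nu> k))
       ({Init} \<union> Disturbance ` {..<N} \<union> Control ` {..<N})"


section \<open>The controlled system and the two policy classes\<close>

text \<open>\<open>x\<close> and \<open>u\<close> are the state and control processes. Feedback policies make \<open>u\<close> depend on \<open>x\<close>;
  as \<open>u k\<close> only uses \<open>x 0, \<dots>, x k\<close>, the relation determines \<open>x 0, \<dots>, x N\<close> uniquely.\<close>

definition trajectory ::
    "'a measure \<Rightarrow> nat \<Rightarrow> (nat \<Rightarrow> real^'n^'n) \<Rightarrow> (nat \<Rightarrow> real^'m^'n) \<Rightarrow> ('a \<Rightarrow> real^'n) \<Rightarrow>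
     (nat \<Rightarrow> 'a \<Rightarrow> real^'n) \<Rightarrow> (nat \<Rightarrow> 'a \<Rightarrow> real^'m) \<Rightarrow> (nat \<Rightarrow> 'a \<Rightarrow> real^'n) \<Rightarrow> bool"
where
  "trajectory M N A B x0 w u x \<longleftrightarrow>
     (\<forall>\<omega>\<in>space M. x 0 \<omega> = x0 \<omega> \<and>
        (\<forall>k<N. x (Suc k) \<omega> = A k *v x k \<omega> + B k *v u k \<omega> + w k \<omega>))"

definition history_feedback ::
    "'a measure \<Rightarrow> (nat \<Rightarrow> real^'m) \<Rightarrow> (nat \<Rightarrow> nat \<Rightarrow> real^'n^'m) \<Rightarrow> (nat \<Rightarrow> 'a \<Rightarrow> real^'n) \<Rightarrow>
     nat \<Rightarrow> 'a \<Rightarrow> real^'m"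
where
  "history_feedback M v K x k \<omega> = v k + (\<Sum>\<tau>\<le>k. K k \<tau> *v (x \<tau> \<omega> - mean M (x \<tau>)))"

definition randomized_feedback ::
    "'a measure \<Rightarrow> (nat \<Rightarrow> real^'m) \<Rightarrow> (nat \<Rightarrow> real^'n^'m) \<Rightarrow> (nat \<Rightarrow> 'a \<Rightarrow> real^'m) \<Rightarrow>
     (nat \<Rightarrow> 'a \<Rightarrow> real^'n) \<Rightarrow> nat \<Rightarrow> 'a \<Rightarrow> real^'m"
where
  "randomized_feedback M v K \<nu> x k \<omega> = v k + K k *v (x k \<omega> - mean M (x k)) + \<nu> k \<omega>"


section \<open>The nonlinear program\<close>

definition nlp_feasible ::
    "nat \<Rightarrow> real^'n \<Rightarrow> real^'n^'n \<Rightarrow> (nat \<Rightarrow> real^'n^'n) \<Rightarrow> (nat \<Rightarrow> real^'m^'n) \<Rightarrow>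
     (nat \<Rightarrow> real^'n^'n) \<Rightarrow> (nat \<Rightarrow> real^'m) \<Rightarrow> (nat \<Rightarrow> real^'n^'m) \<Rightarrow> (nat \<Rightarrow> real^'m^'m) \<Rightarrow>
     (nat \<Rightarrow> real^'n) \<Rightarrow> (nat \<Rightarrow> real^'n^'n) \<Rightarrow> bool"
where
  "nlp_feasible N \<mu>0 S0 A B W v K Q \<mu> S \<longleftrightarrow>
     \<mu> 0 = \<mu>0 \<and> S 0 = S0 \<and>
     (\<forall>k\<le>N. psd (S k)) \<and>
     (\<forall>k<N. psd (Q k) \<and>
        \<mu> (Suc k) = A k *v \<mu> k + B k *v v k \<and>
        S (Suc k) = (A k + B k ** K k) ** S k ** transpose (A k + B k ** K k)
                    + B k ** Q k ** transpose (B k) + W k)"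

text \<open>The term weighted by \<open>lam\<close> is the squared 2-Wasserstein distance between the Gaussian laws
  with parameters \<open>\<mu> N, S N\<close> and \<open>\<mu>d, Sd\<close>.\<close>

definition nlp_objective ::
    "nat \<Rightarrow> real \<Rightarrow> real^'n \<Rightarrow> real^'n^'n \<Rightarrow> (nat \<Rightarrow> real^'m^'m) \<Rightarrow>
     (nat \<Rightarrow> real^'m) \<Rightarrow> (nat \<Rightarrow> real^'n^'m) \<Rightarrow> (nat \<Rightarrow> real^'m^'m) \<Rightarrow>
     (nat \<Rightarrow> real^'n) \<Rightarrow> (nat \<Rightarrow> real^'n^'n) \<Rightarrow> real"
where
  "nlp_objective N lam \<mu>d Sd R v K Q \<mu> S =
     (\<Sum>k<N. v k \<bullet> (R k *v v k) + trace (R k ** (K k ** S k ** transpose (K k) + Q k)))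
     + lam * ((norm (\<mu> N - \<mu>d))\<^sup>2 + trace (S N + Sd)
              - 2 * trace (psd_sqrt (psd_sqrt Sd ** S N ** psd_sqrt Sd)))"

definition nlp_solution ::
    "nat \<Rightarrow> real \<Rightarrow> real^'n \<Rightarrow> real^'n^'n \<Rightarrow> real^'n \<Rightarrow> real^'n^'n \<Rightarrow>
     (nat \<Rightarrow> real^'n^'n) \<Rightarrow> (nat \<Rightarrow> real^'m^'n) \<Rightarrow> (nat \<Rightarrow> real^'n^'n) \<Rightarrow> (nat \<Rightarrow> real^'m^'m) \<Rightarrow>
     (nat \<Rightarrow> real^'m) \<Rightarrow> (nat \<Rightarrow> real^'n^'m) \<Rightarrow> (nat \<Rightarrow> real^'m^'m) \<Rightarrow>
     (nat \<Rightarrow> real^'n) \<Rightarrow> (nat \<Rightarrow> real^'n^'n) \<Rightarrow> bool"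
where
  "nlp_solution N lam \<mu>0 S0 \<mu>d Sd A B W R v K Q \<mu> S \<longleftrightarrow>
     nlp_feasible N \<mu>0 S0 A B W v K Q \<mu> S \<and>
     (\<forall>v' K' Q' \<mu>' S'. nlp_feasible N \<mu>0 S0 A B W v' K' Q' \<mu>' S' \<longrightarrow>
        nlp_objective N lam \<mu>d Sd R v K Q \<mu> S \<le> nlp_objective N lam \<mu>d Sd R v' K' Q' \<mu>' S')"

end

theory Submission
  imports Defs
begin

text \<open>
  The control noise affects the covariances but not the means, and \<open>Q k = 0\<close> follows from comparing
  the solution with policies that differ from it only in \<open>K k\<close> and \<open>Q k\<close>, at the single stage \<open>k\<close>.

  If \<open>K k, Q k\<close> are replaced by other values, \<open>\<Sigma>\<^sub>k\<^sub>+\<^sub>1\<close> changes by some \<open>\<Delta>\<close>, which evolves linearly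
  through the later stages. The terminal cost is differentiable at \<open>\<Sigma>\<^sub>N\<close> because \<open>\<Sigma>\<^sub>N\<close> is positive
  definite, with gradient \<open>\<lambda> (1 - \<Sigma>\<^sub>d\<^sup>1\<^sup>/\<^sup>2 (\<Sigma>\<^sub>d\<^sup>1\<^sup>/\<^sup>2 \<Sigma>\<^sub>N \<Sigma>\<^sub>d\<^sup>1\<^sup>/\<^sup>2)\<^sup>-\<^sup>1\<^sup>/\<^sup>2 \<Sigma>\<^sub>d\<^sup>1\<^sup>/\<^sup>2)\<close>. Transporting this gradient
  backwards by \<open>P\<^sub>j = F\<^sub>j\<^sup>T P\<^sub>j\<^sub>+\<^sub>1 F\<^sub>j + K\<^sub>j\<^sup>T R\<^sub>j K\<^sub>j\<close> with \<open>F\<^sub>j = A\<^sub>j + B\<^sub>j K\<^sub>j\<close> gives a symmetric, in general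
  indefinite, matrix \<open>P = P\<^sub>k\<^sub>+\<^sub>1\<close> such that the objective changes by the change of the cost of stage \<open>k\<close>
  plus \<open>tr (P \<Delta>)\<close>, up to a term quadratic in \<open>\<Delta>\<close> (\<open>nlp_stage_optimality\<close>). The first-order conditions
  for \<open>K k\<close> and \<open>Q k\<close>, combined with the nonsingularity of \<open>\<Sigma>\<^sub>k\<close> and \<open>A k\<close>, then force
  \<open>R k + (B k)\<^sup>T P B k\<close> to be positive definite and \<open>Q k\<close> to vanish (\<open>stage_optimality_imp_no_noise\<close>).

  Two further ingredients are needed. The quadratic estimate for the terminal cost rests on
  \<open>trace_sqrt_lower_bound\<close>, where the error of the linear approximation to the trace of a matrix
  square root is given by an exact identity. The nonsingularity of the covariances (\<open>nlp_covariance_pd\<close>)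
  is deduced from the hypothesis on history feedback: a direction in which some \<open>\<Sigma>\<^sub>k\<close> degenerates is
  a direction in which the closed loop with the same gains and without control noise is almost
  surely constant, and that closed loop is a history feedback.
\<close>

section \<open>Matrix algebra and traces\<close>

(* This simp rule turns transpose X *v x into a row vector product, to which the
   rules about *v below do not apply. *)
declare transpose_matrix_vector [simp del]

lemma bounded_bilinear_matrix_mult:
  "bounded_bilinear ((**) :: real^'n^'m \<Rightarrow> real^'p^'n \<Rightarrow> real^'p^'m)"
proof -
  have "bilinear ((**) :: real^'n^'m \<Rightarrow> real^'p^'n \<Rightarrow> real^'p^'m)"
    unfolding bilinear_def
    by (auto intro!: linearI simp: matrix_add_ldistrib matrix_scalar_ac scalar_matrix_assoc)
      (simp add: matrix_matrix_mult_def vec_eq_iff distrib_right sum.distrib)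
  then show ?thesis
    by (simp add: bilinear_conv_bounded_bilinear)
qed

interpretation mm: bounded_bilinear "(**) :: real^'n^'m \<Rightarrow> real^'p^'n \<Rightarrow> real^'p^'m"
  by (rule bounded_bilinear_matrix_mult)

lemma transpose_add: "transpose (X + Y) = transpose X + transpose (Y :: real^'n^'m)"
  and transpose_diff: "transpose (X - Y) = transpose X - transpose (Y :: real^'n^'m)"
  and transpose_zero: "transpose (0 :: real^'n^'m) = 0"
  by (simp_all add: transpose_def vec_eq_iff)

lemma trace_scaleR: "trace (c *\<^sub>R (X :: real^'n^'n)) = c * trace X"
  and trace_uminus: "trace (- X) = - trace X"
  and trace_zero: "trace (0 :: real^'n^'n) = 0"
  and trace_transpose: "trace (transpose X) = trace X"
  by (simp_all add: trace_def sum_distrib_left sum_negf transpose_def)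

lemma inner_transpose_left: "(transpose X *v x) \<bullet> y = x \<bullet> ((X :: real^'n^'m) *v y)"
  by (simp add: transpose_matrix_vector dot_lmul_matrix)

lemma inner_symmetric_swap:
  "transpose X = X \<Longrightarrow> (X *v x) \<bullet> y = x \<bullet> ((X :: real^'n^'n) *v y)"
  using inner_transpose_left[of X x y] by simp

text \<open>The inner product of the type of matrices is the Frobenius inner product, so that
  Cauchy--Schwarz becomes available for traces.\<close>

lemma trace_transpose_mult: "trace (transpose X ** Y) = X \<bullet> (Y :: real^'n^'m)"
  unfolding trace_def matrix_matrix_mult_def transpose_def inner_vec_def
  by (simp, subst sum.swap) simp

section \<open>Positive semidefinite matrices\<close>

text \<open>A vector at which a nonnegative quadratic form vanishes is a minimum of it, so the derivative
  there vanishes in every direction \<open>y\<close>. This is used for kernels of semidefinite matrices and for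
  the variational construction of eigenvectors.\<close>

lemma nonneg_form_zero_imp_orthogonal:
  fixes g :: "'a::real_inner \<Rightarrow> 'a"
  assumes "linear g" and sym: "\<And>x y. g x \<bullet> y = x \<bullet> g y"
    and "subspace V" and nonneg: "\<And>x. x \<in> V \<Longrightarrow> 0 \<le> x \<bullet> g x"
    and "e \<in> V" "e \<bullet> g e = 0" "y \<in> V"
  shows "y \<bullet> g e = 0"
proof -
  define b c where "b = y \<bullet> g e" and "c = y \<bullet> g y"
  have "0 \<le> c" using nonneg[OF \<open>y \<in> V\<close>] by (simp add: c_def)
  have q: "0 \<le> 2 * t * b + t\<^sup>2 * c" for t
  proof -
    have "0 \<le> (e + t *\<^sub>R y) \<bullet> g (e + t *\<^sub>R y)"
      using assms by (intro nonneg subspace_add subspace_scale)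
    also have "\<dots> = 2 * t * b + t\<^sup>2 * c"
      using sym[of e y] assms(6)
      by (simp add: linear_add[OF \<open>linear g\<close>] linear_cmul[OF \<open>linear g\<close>] inner_add_left
          inner_add_right b_def c_def power2_eq_square inner_commute[of "g e" y] algebra_simps)
    finally show ?thesis .
  qed
  \<comment> \<open>The minimiser of the quadratic is \<open>- b / c\<close>; the denominator \<open>c + 1\<close> covers \<open>c = 0\<close> as well.\<close>
  have "2 * (- b / (c + 1)) * b + (- b / (c + 1))\<^sup>2 * c = - (b\<^sup>2 * (c + 2) / (c + 1)\<^sup>2)"
    using \<open>0 \<le> c\<close> by (simp add: power2_eq_square divide_simps) (simp add: algebra_simps)
  with q[of "- b / (c + 1)"] have "b\<^sup>2 * (c + 2) / (c + 1)\<^sup>2 \<le> 0" by simp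
  then have "b\<^sup>2 * (c + 2) \<le> 0"
    using \<open>0 \<le> c\<close> by (simp add: divide_le_0_iff)
  then have "b = 0"
    using \<open>0 \<le> c\<close> by (simp add: mult_le_0_iff)
  then show ?thesis by (simp add: b_def)
qed

lemma psd_imp_sym: "psd S \<Longrightarrow> transpose S = S"
  and psd_nonneg: "psd S \<Longrightarrow> 0 \<le> x \<bullet> (S *v x)"
  and pd_imp_psd: "pd S \<Longrightarrow> psd S"
proof -
  show "psd S \<Longrightarrow> transpose S = S" and "psd S \<Longrightarrow> 0 \<le> x \<bullet> (S *v x)"
    by (simp_all add: psd_def)
  show "psd S" if "pd S"
    unfolding psd_def
  proof (intro conjI allI)
    show "0 \<le> x \<bullet> (S *v x)" for x
      using that by (cases "x = 0") (auto simp: pd_def less_imp_le)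
  qed (use that in \<open>simp add: pd_def\<close>)
qed

lemma psd_kernel:
  assumes "psd S" "x \<bullet> (S *v x) = 0"
  shows "S *v x = 0"
proof -
  have "(S *v x) \<bullet> (S *v x) = 0"
    by (rule nonneg_form_zero_imp_orthogonal[where V = UNIV and g = "(*v) S" and e = x])
      (simp_all add: assms psd_nonneg inner_symmetric_swap psd_imp_sym)
  then show ?thesis by simp
qed

lemma psd_add: "psd S \<Longrightarrow> psd T \<Longrightarrow> psd (S + T)"
  by (simp add: psd_def transpose_add matrix_vector_mult_add_rdistrib inner_add_right)

lemma psd_scaleR: "psd S \<Longrightarrow> 0 \<le> c \<Longrightarrow> psd (c *\<^sub>R S)"
  by (simp add: psd_def transpose_scalar scaleR_matrix_vector_assoc[symmetric])

lemma congruence_form: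
  "x \<bullet> (((F :: real^'n^'m) ** S ** transpose F) *v x) = (transpose F *v x) \<bullet> (S *v (transpose F *v x))"
  by (simp add: inner_transpose_left flip: matrix_vector_mul_assoc)

lemma psd_congruence: "psd S \<Longrightarrow> psd ((F :: real^'n^'m) ** S ** transpose F)"
  unfolding psd_def by (auto simp: congruence_form matrix_transpose_mul matrix_mul_assoc)

lemma trace_congruence:
  "trace (X ** S ** transpose X) = (\<Sum>i\<in>UNIV. (X :: real^'n^'m) $ i \<bullet> (S *v X $ i))"
proof -
  have "(X ** S ** transpose X) $ i $ i = X $ i \<bullet> (S *v X $ i)" for i
  proof -
    have "transpose X *v axis i 1 = X $ i"
      by (simp add: matrix_vector_mult_basis column_def transpose_def vec_eq_iff)
    moreover have "Y $ i $ i = axis i 1 \<bullet> (Y *v axis i 1)" for Y :: "real^'m^'m"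
      by (simp add: matrix_vector_mult_basis column_def inner_axis')
    ultimately show ?thesis by (simp add: congruence_form)
  qed
  then show ?thesis by (simp add: trace_def)
qed

lemma trace_congruence_nonneg: "psd S \<Longrightarrow> 0 \<le> trace ((X :: real^'n^'m) ** S ** transpose X)"
  unfolding trace_congruence by (intro sum_nonneg) (simp add: psd_nonneg)

lemma trace_congruence_pd_eq_0:
  assumes "pd S" "trace ((X :: real^'n^'m) ** S ** transpose X) \<le> 0"
  shows "X = 0"
proof -
  have "trace (X ** S ** transpose X) = 0"
    using assms trace_congruence_nonneg pd_imp_psd by (metis order.antisym)
  then have "X $ i \<bullet> (S *v X $ i) = 0" for i
    unfolding trace_congruence using assms(1)
    by (subst (asm) sum_nonneg_eq_0_iff) (auto simp: psd_nonneg pd_imp_psd)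
  then have "X $ i = 0" for i
    using assms(1) unfolding pd_def by (metis less_irrefl)
  then show ?thesis by (simp add: vec_eq_iff)
qed

section \<open>Square roots of positive semidefinite matrices\<close>

text \<open>A maximiser \<open>e\<close> of \<open>x \<bullet> f x\<close> on the unit sphere of an invariant subspace, with maximum \<open>c\<close>, is an
  eigenvector: the form of \<open>c - f\<close> is nonnegative on the subspace and vanishes at \<open>e\<close>.\<close>

lemma self_adjoint_eigenvector_exists:
  fixes f :: "'a::euclidean_space \<Rightarrow> 'a"
  assumes lin: "linear f" and sym: "\<And>x y. f x \<bullet> y = x \<bullet> f y"
    and V: "subspace V" "f ` V \<subseteq> V" "V \<noteq> {0}"
  obtains e c where "e \<in> V" "norm e = 1" "f e = c *\<^sub>R e"
proof -
  let ?U = "V \<inter> sphere 0 1"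
  have "compact ?U"
    using V(1) by (intro closed_Int_compact closed_subspace compact_sphere)
  obtain y where "y \<in> V" "y \<noteq> 0" using V(1,3) subspace_0 by blast
  then have "(1 / norm y) *\<^sub>R y \<in> ?U"
    using V(1) by (simp add: subspace_scale)
  then have "?U \<noteq> {}" by blast
  moreover have "continuous_on ?U (\<lambda>x. x \<bullet> f x)"
    using lin by (intro continuous_intros linear_continuous_on linear_linear[THEN iffD1])
      (simp add: linear_conv_bounded_linear)
  ultimately obtain e where e: "e \<in> ?U" and max: "\<And>x. x \<in> ?U \<Longrightarrow> x \<bullet> f x \<le> e \<bullet> f e"
    using continuous_attains_sup[OF \<open>compact ?U\<close>] by blast
  define c where "c = e \<bullet> f e"
  define g where "g = (\<lambda>x. c *\<^sub>R x - f x)"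
  have "linear g" unfolding g_def
    using lin by (intro linear_compose_sub linear_cmul) (simp_all add: linear_iff scaleR_add_right)
  have gV: "g x \<in> V" if "x \<in> V" for x
    using that V unfolding g_def by (intro subspace_diff subspace_scale) auto
  have ee: "e \<bullet> e = 1" using e by (simp add: dot_square_norm)
  have "0 \<le> x \<bullet> g x" if "x \<in> V" for x
  proof (cases "x = 0")
    case False
    have "(1 / norm x) *\<^sub>R x \<in> ?U" using that V(1) False by (simp add: subspace_scale)
    from max[OF this] have "(x \<bullet> f x) / (norm x)\<^sup>2 \<le> c"
      by (simp add: c_def linear_cmul[OF lin] power2_eq_square)
    then have "x \<bullet> f x \<le> c * (x \<bullet> x)"
      using False by (simp add: field_simps dot_square_norm)
    then show ?thesis by (simp add: g_def inner_diff_right)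
  qed simp
  moreover have "e \<bullet> g e = 0" by (simp add: g_def inner_diff_right ee c_def)
  ultimately have "g e \<bullet> g e = 0"
    using \<open>linear g\<close> V(1) e gV
    by (intro nonneg_form_zero_imp_orthogonal[where V = V and g = g and e = e and y = "g e"])
      (auto simp: g_def inner_diff_left inner_diff_right sym)
  then have "f e = c *\<^sub>R e" by (simp add: g_def)
  then show ?thesis using that e by auto
qed

text \<open>The spectral theorem: split off one eigenvector and continue in its orthogonal complement,
  which is again invariant because \<open>f\<close> is self-adjoint.\<close>

lemma self_adjoint_orthonormal_eigenbasis:
  fixes f :: "'a::euclidean_space \<Rightarrow> 'a"
  assumes lin: "linear f" and sym: "\<And>x y. f x \<bullet> y = x \<bullet> f y"
  shows "subspace V \<Longrightarrow> f ` V \<subseteq> V \<Longrightarrow>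
    \<exists>B\<subseteq>V. pairwise orthogonal B \<and> (\<forall>e\<in>B. norm e = 1 \<and> (\<exists>c. f e = c *\<^sub>R e)) \<and> span B = V"
proof (induction "dim V" arbitrary: V rule: less_induct)
  case less
  show ?case
  proof (cases "V = {0}")
    case True
    then show ?thesis by (intro exI[of _ "{}"]) auto
  next
    case False
    then obtain e c where e: "e \<in> V" "norm e = 1" and fe: "f e = c *\<^sub>R e"
      using self_adjoint_eigenvector_exists[OF lin sym less.prems] by blast
    define V' where "V' = {y \<in> V. e \<bullet> y = 0}"
    have sub: "subspace V'"
      using less.prems(1) by (auto simp: V'_def subspace_def inner_add_right)
    have "e \<notin> V'" using e by (auto simp: V'_def)
    moreover have "V' \<subseteq> V" by (auto simp: V'_def)
    ultimately have "V' \<subset> V" using e(1) by blast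
    then have "dim V' < dim V"
      using sub less.prems(1) dim_psubset[of V' V] by (simp add: span_eq_iff[THEN iffD2])
    moreover have "f ` V' \<subseteq> V'"
      using less.prems(2) by (auto simp: V'_def fe simp flip: sym)
    ultimately have "\<exists>B\<subseteq>V'. pairwise orthogonal B \<and>
        (\<forall>e\<in>B. norm e = 1 \<and> (\<exists>c. f e = c *\<^sub>R e)) \<and> span B = V'"
      using sub by (intro less.hyps)
    then obtain B where B: "B \<subseteq> V'" "pairwise orthogonal B"
      "\<forall>e\<in>B. norm e = 1 \<and> (\<exists>c. f e = c *\<^sub>R e)" "span B = V'"
      by blast
    have "V \<subseteq> span (insert e B)"
    proof
      fix y assume "y \<in> V"
      have "y - (e \<bullet> y) *\<^sub>R e \<in> V'"
        using \<open>y \<in> V\<close> e less.prems(1)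
        by (auto simp: V'_def subspace_diff subspace_scale inner_diff_right dot_square_norm)
      then show "y \<in> span (insert e B)"
        using B(4) by (auto simp: span_breakdown_eq)
    qed
    moreover have "span (insert e B) \<subseteq> V"
      using B(1) e less.prems(1) by (intro span_minimal) (auto simp: V'_def)
    moreover have "pairwise orthogonal (insert e B)"
      using B(1,2) by (auto simp: pairwise_insert V'_def orthogonal_def inner_commute)
    ultimately show ?thesis
      using B e fe by (intro exI[of _ "insert e B"]) (auto simp: V'_def)
  qed
qed

lemma psd_sqrt_exists:
  assumes "psd S"
  obtains T where "psd T" "T ** T = S"
proof -
  let ?f = "(*v) S"
  have "\<exists>B\<subseteq>UNIV. pairwise orthogonal B \<and> (\<forall>e\<in>B. norm e = 1 \<and> (\<exists>c. ?f e = c *\<^sub>R e)) \<and> span B = UNIV"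
    by (rule self_adjoint_orthonormal_eigenbasis)
      (use assms in \<open>auto simp: psd_imp_sym inner_symmetric_swap\<close>)
  then obtain B where B: "pairwise orthogonal B" "\<And>e. e \<in> B \<Longrightarrow> norm e = 1" "span B = UNIV"
    and "\<forall>e\<in>B. \<exists>c. S *v e = c *\<^sub>R e" by blast
  then obtain c where c: "\<And>e. e \<in> B \<Longrightarrow> S *v e = c e *\<^sub>R e" by metis
  have fin: "finite B" using B(1) by (rule pairwise_orthogonal_imp_finite)
  have c0: "0 \<le> c e" if "e \<in> B" for e
    using psd_nonneg[OF assms, of e] B(2)[OF that] by (simp add: c[OF that] dot_square_norm)
  define g where "g = (\<lambda>x. \<Sum>e\<in>B. (sqrt (c e) * (e \<bullet> x)) *\<^sub>R e)"
  have lin: "linear g"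
    by (rule linearI) (simp_all add: g_def inner_add_right distrib_left scaleR_add_left
        sum.distrib scaleR_sum_right mult_ac)
  have ge: "g e = sqrt (c e) *\<^sub>R e" if "e \<in> B" for e
  proof -
    have "g e = (\<Sum>d\<in>B. if d = e then sqrt (c e) *\<^sub>R e else 0)"
      unfolding g_def using B that
      by (intro sum.cong refl) (auto simp: pairwise_def orthogonal_def dot_square_norm)
    then show ?thesis using that fin by simp
  qed
  define T where "T = matrix g"
  have T: "T *v x = g x" for x
    unfolding T_def using lin by (simp add: matrix_works)
  have "x \<bullet> g y = g x \<bullet> y" for x y
    unfolding g_def inner_sum_right inner_sum_left
    by (intro sum.cong refl) (simp add: inner_commute)
  then have "transpose T *v x = T *v x" for x
    by (intro vector_eq_ldot[THEN iffD1]) (metis T inner_commute inner_transpose_left)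
  then have "transpose T = T" by (simp add: matrix_eq)
  moreover have "0 \<le> x \<bullet> (T *v x)" for x
    unfolding T g_def inner_sum_right
    by (intro sum_nonneg) (auto simp: c0 inner_commute mult.assoc intro!: mult_nonneg_nonneg)
  moreover have "T ** T = S"
  proof -
    have "(T ** T) *v x = S *v x" for x
    proof (rule linear_eq_on_span[where B = B and f = "\<lambda>x. (T ** T) *v x"])
      show "(T ** T) *v e = S *v e" if "e \<in> B" for e
        using that c0 by (simp add: T ge c matrix_vector_mult_scaleR flip: matrix_vector_mul_assoc)
    qed (use B(3) in auto)
    then show ?thesis by (simp add: matrix_eq)
  qed
  ultimately show ?thesis using that unfolding psd_def by blast
qed

text \<open>The trace is the sum of the values of the form of \<open>S\<close> at the columns of \<open>X\<close>, all of which must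
  vanish, so every column lies in the kernel of \<open>S\<close>.\<close>

lemma psd_mult_zero:
  assumes "psd S" "transpose X = X" "trace (X ** S ** X) \<le> 0"
  shows "S ** X = 0"
proof -
  have "trace (X ** S ** transpose X) = 0"
    using trace_congruence_nonneg[OF assms(1), of X] assms(2,3) by simp
  then have "X $ i \<bullet> (S *v X $ i) = 0" for i
    unfolding trace_congruence using assms(1)
    by (subst (asm) sum_nonneg_eq_0_iff) (auto simp: psd_nonneg)
  then have "S *v X $ i = 0" for i
    using psd_kernel[OF assms(1)] by blast
  then have "S *v (transpose X $ i) = 0" for i using assms(2) by simp
  then have "(S ** X) $ i $ j = 0" for i j
    by (simp add: vec_eq_iff matrix_matrix_mult_def matrix_vector_mult_def transpose_def)
  then show ?thesis by (simp add: vec_eq_iff)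
qed

text \<open>For the difference \<open>E = S - T\<close>, the equation \<open>S\<^sup>2 = T\<^sup>2\<close> reads \<open>S E + E T = 0\<close>; multiplying by \<open>E\<close>
  and taking traces writes zero as a sum of two nonnegative terms.\<close>

lemma psd_sqrt_unique:
  assumes "psd S" "psd T" "S ** S = T ** T"
  shows "S = T"
proof -
  define E where "E = S - T"
  have sym: "transpose E = E" using assms by (simp add: E_def transpose_diff psd_imp_sym)
  have "S ** E + E ** T = 0"
    using assms(3) by (simp add: E_def mm.diff_right mm.diff_left)
  then have "trace (E ** (S ** E + E ** T)) = 0" by (simp add: trace_zero)
  then have "trace (E ** S ** E) + trace (E ** T ** E) = 0"
    by (metis trace_add trace_mul_sym matrix_mul_assoc mm.add_right)
  moreover have "0 \<le> trace (E ** S ** E)" "0 \<le> trace (E ** T ** E)"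
    using trace_congruence_nonneg[of _ E] assms sym by auto
  ultimately have "S ** E = 0" "T ** E = 0"
    using assms sym by (auto intro!: psd_mult_zero)
  then have "transpose E ** E = 0" by (simp only: sym) (simp add: E_def mm.diff_left)
  then have "E \<bullet> E = 0" by (metis trace_transpose_mult trace_zero)
  then show ?thesis by (simp add: E_def)
qed

lemma psd_sqrt_eqI: "psd T \<Longrightarrow> T ** T = S \<Longrightarrow> psd_sqrt S = T"
  unfolding psd_sqrt_def by (rule the_equality) (auto intro: psd_sqrt_unique)

lemma psd_sqrt:
  assumes "psd S"
  shows psd_psd_sqrt: "psd (psd_sqrt S)" and psd_sqrt_square: "psd_sqrt S ** psd_sqrt S = S"
  using psd_sqrt_exists[OF assms] psd_sqrt_eqI by metis+

lemma pd_psd_sqrt: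
  assumes "pd S"
  shows "pd (psd_sqrt S)"
proof -
  let ?T = "psd_sqrt S"
  note T = psd_sqrt[OF pd_imp_psd[OF assms]]
  have "x = 0" if "x \<bullet> (?T *v x) = 0" for x
  proof -
    have "S *v x = ?T *v (?T *v x)" using T(2) by (simp add: matrix_vector_mul_assoc)
    also have "\<dots> = 0" using psd_kernel[OF T(1) that] by simp
    finally show ?thesis using assms unfolding pd_def by (metis inner_zero_right less_irrefl)
  qed
  then show ?thesis
    using T(1) unfolding pd_def psd_def by (metis order_le_less)
qed

section \<open>Second-order lower bound for the trace of the square root\<close>

lemma pd_coercive:
  assumes "pd (S :: real^'n^'n)"
  obtains s where "0 < s" "\<And>x. s * (x \<bullet> x) \<le> x \<bullet> (S *v x)"
proof -
  let ?U = "sphere 0 1 :: (real^'n) set"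
  have "axis undefined 1 \<in> ?U" by (simp add: norm_axis_1)
  then have "?U \<noteq> {}" by blast
  moreover have "continuous_on ?U (\<lambda>x. x \<bullet> (S *v x))"
    by (intro continuous_intros linear_continuous_on matrix_vector_mul_bounded_linear)
  ultimately obtain u where u: "u \<in> ?U" "\<And>x. x \<in> ?U \<Longrightarrow> u \<bullet> (S *v u) \<le> x \<bullet> (S *v x)"
    using continuous_attains_inf[OF compact_sphere] by blast
  have "u \<bullet> (S *v u) * (x \<bullet> x) \<le> x \<bullet> (S *v x)" for x
  proof (cases "x = 0")
    case False
    have "u \<bullet> (S *v u) \<le> ((1 / norm x) *\<^sub>R x) \<bullet> (S *v ((1 / norm x) *\<^sub>R x))"
      using False by (intro u(2)) simp
    then show ?thesis
      using False by (simp add: matrix_vector_mult_scaleR field_simps dot_square_norm power2_eq_square)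
  qed simp
  moreover have "0 < u \<bullet> (S *v u)"
    using u(1) assms unfolding pd_def by (metis mem_sphere_0 norm_zero zero_neq_one)
  ultimately show ?thesis using that by blast
qed

lemma trace_mult_le_norm: "trace (X ** Y) \<le> norm (X :: real^'n^'m) * norm (Y :: real^'m^'n)"
proof -
  have "norm (transpose X) = norm X"
    by (metis norm_eq_sqrt_inner trace_mul_sym trace_transpose_mult transpose_transpose)
  then show ?thesis
    using trace_transpose_mult[of "transpose X" Y] norm_cauchy_schwarz[of "transpose X" Y] by simp
qed

text \<open>The function \<open>M \<mapsto> tr (M\<^sup>1\<^sup>/\<^sup>2)\<close> is concave, hence lies below its tangents; first-order conditions
  for a problem that maximises it need the opposite estimate, up to a quadratic error. With
  \<open>E = T - S\<close> and \<open>D = T\<^sup>2 - S\<^sup>2 = S E + E S + E\<^sup>2\<close> the linear part of the bound gives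
  \<open>tr (S\<^sup>-\<^sup>1 D) / 2 = tr E + tr (S\<^sup>-\<^sup>1 E\<^sup>2) / 2\<close>, so the error is exactly the last term. It is quadratic in
  \<open>D\<close> because \<open>D = T E + E S\<close> gives \<open>tr (E D) \<ge> tr (E S E) \<ge> s \<parallel>E\<parallel>\<^sup>2\<close>, where \<open>s > 0\<close> is a lower bound for
  the spectrum of \<open>S\<close>; that is, the square root is Lipschitz at \<open>S\<^sup>2\<close>.\<close>

lemma trace_sqrt_lower_bound:
  fixes S :: "real^'n^'n"
  assumes "pd S"
  obtains X c where "transpose X = X"
    "\<And>T. psd T \<Longrightarrow> trace S + trace (X ** (T ** T - S ** S)) / 2 - c * (norm (T ** T - S ** S))\<^sup>2 \<le> trace T"
proof -
  have sym: "transpose S = S" using assms by (simp add: pd_def)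
  obtain s where s: "0 < s" "\<And>x. s * (x \<bullet> x) \<le> x \<bullet> (S *v x)"
    using pd_coercive[OF assms] by blast
  have "\<exists>X. X ** S = mat 1"
    unfolding matrix_left_invertible_ker using assms by (metis pd_def inner_zero_right less_irrefl)
  then obtain X where XS: "X ** S = mat 1" by blast
  then have SX: "S ** X = mat 1" using matrix_left_right_inverse by blast
  have "transpose X = transpose X ** (S ** X)" by (simp add: SX)
  also have "\<dots> = transpose (S ** X) ** X" by (simp add: matrix_transpose_mul sym matrix_mul_assoc)
  also have "\<dots> = X" by (simp add: SX)
  finally have symX: "transpose X = X" .
  obtain C where C: "0 < C" "\<And>Y Z. norm (Y ** Z) \<le> norm (Y :: real^'n^'n) * norm (Z :: real^'n^'n) * C"
    using mm.pos_bounded by blast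
  have "trace S + trace (X ** (T ** T - S ** S)) / 2
      - (norm X * C / (2 * s\<^sup>2)) * (norm (T ** T - S ** S))\<^sup>2 \<le> trace T" if T: "psd T" for T
  proof -
    define E D where "E = T - S" and "D = T ** T - S ** S"
    have symE: "transpose E = E" by (simp add: E_def transpose_diff psd_imp_sym[OF T] sym)
    have D1: "D = T ** E + E ** S" and D2: "D = S ** E + E ** S + E ** E"
      by (simp_all add: D_def E_def mm.diff_left mm.diff_right)
    have "X ** (S ** E) = E" by (simp add: matrix_mul_assoc XS)
    moreover have "trace (X ** (E ** S)) = trace (E ** (S ** X))"
      by (metis matrix_mul_assoc trace_mul_sym)
    ultimately have "trace (X ** D) = 2 * trace E + trace (X ** (E ** E))"
      by (simp add: D2 mm.add_right trace_add SX)
    moreover have "trace E = trace T - trace S" by (simp add: E_def trace_sub)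
    ultimately have id: "trace T = trace S + trace (X ** D) / 2 - trace (X ** (E ** E)) / 2"
      by linarith
    have "s * (E \<bullet> E) \<le> trace (E ** S ** transpose E)"
      unfolding trace_congruence inner_vec_def[of E] sum_distrib_left by (intro sum_mono s(2))
    also have "\<dots> \<le> trace (E ** S ** transpose E) + trace (E ** T ** transpose E)"
      using trace_congruence_nonneg[OF T, of E] by simp
    also have "\<dots> = trace (E ** D)"
    proof -
      have "trace (E ** (E ** S)) = trace (E ** S ** E)" by (metis matrix_mul_assoc trace_mul_sym)
      then show ?thesis by (simp add: symE D1 mm.add_right trace_add matrix_mul_assoc)
    qed
    also have "\<dots> \<le> norm E * norm D" by (rule trace_mult_le_norm)
    finally have "norm E * (s * norm E) \<le> norm E * norm D"
      by (simp add: dot_square_norm power2_eq_square mult_ac)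
    then have "norm E \<le> norm D / s"
      using s(1) by (cases "norm E = 0") (auto simp: field_simps)
    then have EE: "(norm E)\<^sup>2 \<le> (norm D / s)\<^sup>2" by (intro power_mono) auto
    have "trace (X ** (E ** E)) \<le> norm X * (norm E * norm E * C)"
      using trace_mult_le_norm[of X "E ** E"] C(2)[of E E]
      by (meson mult_left_mono norm_ge_zero order_trans)
    also have "\<dots> = norm X * C * (norm E)\<^sup>2" by (simp add: power2_eq_square)
    also have "\<dots> \<le> norm X * C * (norm D / s)\<^sup>2"
      using EE C(1) by (intro mult_left_mono) auto
    also have "\<dots> = 2 * ((norm X * C / (2 * s\<^sup>2)) * (norm D)\<^sup>2)"
      by (simp add: power_divide)
    finally show ?thesis unfolding id D_def[symmetric] by linarith
  qed
  then show ?thesis using that[OF symX] by blast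
qed

lemma norm_congruence_bounded:
  obtains b where "0 \<le> b"
    "\<And>X. norm ((F :: real^'n^'m) ** X ** (G :: real^'k^'p)) \<le> b * norm (X :: real^'p^'n)"
proof -
  have "bounded_linear (\<lambda>X. F ** X ** G)"
    using bounded_linear_compose[OF mm.bounded_linear_left[of G] mm.bounded_linear_right[of F]]
    by (simp add: o_def)
  from bounded_linear.nonneg_bounded[OF this] obtain b
    where "0 \<le> b" "\<And>X. norm (F ** X ** G) \<le> norm X * b" by blast
  then show ?thesis using that[of b] by (simp add: mult.commute)
qed

text \<open>The form of the bound that occurs in the Wasserstein distance, with \<open>L\<close> the square root of the
  desired terminal covariance and \<open>G = L (L S L)\<^sup>-\<^sup>1\<^sup>/\<^sup>2 L\<close>.\<close>

lemma trace_psd_sqrt_congruence_lower_bound: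
  fixes L S :: "real^'n^'n"
  assumes "pd L" "pd S"
  obtains G c where "transpose G = G" "0 \<le> c"
    "\<And>S'. psd S' \<Longrightarrow> trace (psd_sqrt (L ** S ** L)) + trace (G ** (S' - S)) / 2 - c * (norm (S' - S))\<^sup>2
       \<le> trace (psd_sqrt (L ** S' ** L))"
proof -
  have symL: "transpose L = L" using assms by (simp add: pd_def)
  have psdL: "psd (L ** S' ** L)" if "psd S'" for S'
    using psd_congruence[OF that, of L] by (simp add: symL)
  have "L *v x \<noteq> 0" if "x \<noteq> 0" for x
    using assms(1) that by (metis pd_def inner_zero_right less_irrefl)
  then have "pd (L ** S ** L)"
    using assms psdL[OF pd_imp_psd[OF assms(2)]] congruence_form[of _ L S]
    unfolding pd_def psd_def by (simp add: symL)
  then have "pd (psd_sqrt (L ** S ** L))" by (rule pd_psd_sqrt)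
  then obtain X c where symX: "transpose X = X" and X: "\<And>T. psd T \<Longrightarrow>
     trace (psd_sqrt (L ** S ** L)) + trace (X ** (T ** T - L ** S ** L)) / 2
      - c * (norm (T ** T - L ** S ** L))\<^sup>2 \<le> trace T"
    using trace_sqrt_lower_bound psd_sqrt_square[OF psdL[OF pd_imp_psd[OF assms(2)]]] by metis
  obtain b where b: "0 \<le> b" "\<And>X. norm (L ** X ** L) \<le> b * norm X"
    using norm_congruence_bounded by blast
  have "trace (psd_sqrt (L ** S ** L)) + trace ((L ** X ** L) ** (S' - S)) / 2
      - (\<bar>c\<bar> * b\<^sup>2) * (norm (S' - S))\<^sup>2 \<le> trace (psd_sqrt (L ** S' ** L))" if "psd S'" for S'
  proof -
    have diff: "L ** S' ** L - L ** S ** L = L ** (S' - S) ** L"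
      by (simp add: mm.diff_left mm.diff_right)
    have "trace (X ** (L ** (S' - S) ** L)) = trace ((L ** X ** L) ** (S' - S))"
      by (metis matrix_mul_assoc trace_mul_sym)
    then have "trace (psd_sqrt (L ** S ** L)) + trace ((L ** X ** L) ** (S' - S)) / 2
        - c * (norm (L ** (S' - S) ** L))\<^sup>2 \<le> trace (psd_sqrt (L ** S' ** L))"
      using X[OF psd_psd_sqrt[OF psdL[OF that]]] psd_sqrt_square[OF psdL[OF that]] diff by simp
    moreover have "c * (norm (L ** (S' - S) ** L))\<^sup>2 \<le> \<bar>c\<bar> * (b * norm (S' - S))\<^sup>2"
      using b by (intro mult_mono power_mono) auto
    ultimately show ?thesis by (simp add: power_mult_distrib mult_ac)
  qed
  moreover have "transpose (L ** X ** L) = L ** X ** L"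
    by (simp add: matrix_transpose_mul symL symX matrix_mul_assoc)
  ultimately show ?thesis using that[of "L ** X ** L" "\<bar>c\<bar> * b\<^sup>2"] by simp
qed

section \<open>First-order conditions at a single stage\<close>

definition stage_cost :: "real^'m^'m \<Rightarrow> real^'n^'m \<Rightarrow> real^'m^'m \<Rightarrow> real^'n^'n \<Rightarrow> real" where
  "stage_cost R K Q S = trace (R ** (K ** S ** transpose K + Q))"

text \<open>The disturbance covariance is left out: it is added at every stage whatever the control, so it
  cancels when two controls are compared.\<close>

definition controlled_cov ::
    "real^'n^'n \<Rightarrow> real^'m^'n \<Rightarrow> real^'n^'m \<Rightarrow> real^'m^'m \<Rightarrow> real^'n^'n \<Rightarrow> real^'n^'n"
where
  "controlled_cov A B K Q S =
     (A + B ** K) ** S ** transpose (A + B ** K) + B ** Q ** transpose B"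

lemma quadratic_nonneg_imp_slope_nonneg:
  assumes "\<And>t::real. 0 < t \<Longrightarrow> t \<le> 1 \<Longrightarrow> 0 \<le> a * t + b * t\<^sup>2"
  shows "0 \<le> a"
proof (rule ccontr)
  assume "\<not> 0 \<le> a"
  define t where "t = min 1 (- a / (2 * (\<bar>b\<bar> + 1)))"
  have t: "0 < t" "t \<le> 1"
    using \<open>\<not> 0 \<le> a\<close> by (auto simp: t_def intro!: divide_neg_pos)
  have "t \<le> - a / (2 * (\<bar>b\<bar> + 1))" by (simp add: t_def)
  then have "t * (2 * (\<bar>b\<bar> + 1)) \<le> - a"
    by (subst (asm) pos_le_divide_eq) auto
  then have bt: "2 * (\<bar>b\<bar> * t) + 2 * t \<le> - a" by (simp add: algebra_simps)
  have "0 \<le> t * (a + b * t)"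
    using assms[OF t] by (simp add: power2_eq_square algebra_simps)
  then have "0 \<le> a + b * t" using t(1) by (simp add: zero_le_mult_iff)
  moreover have "b * t \<le> \<bar>b\<bar> * t" using t(1) by (intro mult_right_mono) auto
  ultimately show False using t bt \<open>\<not> 0 \<le> a\<close> by linarith
qed

lemma trace_mult_pd_psd_eq_0:
  assumes "pd H" "psd Q" "trace (H ** Q) \<le> 0"
  shows "Q = 0"
proof -
  obtain T where T: "psd T" "T ** T = Q" using psd_sqrt_exists[OF assms(2)] by blast
  have "trace (T ** H ** transpose T) = trace (H ** Q)"
    using T by (metis psd_imp_sym matrix_mul_assoc trace_mul_sym)
  then have "T = 0" using assms by (intro trace_congruence_pd_eq_0) auto
  then show ?thesis using T by simp
qed

lemma trace_rank_one:
  fixes H :: "real^'n^'n" and z :: "real^'n"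
  defines "E \<equiv> (\<chi> i j. z $ i * z $ j)"
  shows "psd E" and "trace (H ** E) = z \<bullet> (H *v z)"
proof -
  have "E *v x = (z \<bullet> x) *\<^sub>R z" for x
    by (simp add: E_def matrix_vector_mult_def inner_vec_def vec_eq_iff sum_distrib_left
        sum_distrib_right mult_ac)
  then have "0 \<le> x \<bullet> (E *v x)" for x by (simp add: inner_commute)
  then show "psd E" by (simp add: psd_def E_def transpose_def vec_eq_iff mult.commute)
  show "trace (H ** E) = z \<bullet> (H *v z)"
    by (simp add: E_def trace_def matrix_matrix_mult_def matrix_vector_mult_def inner_vec_def
        sum_distrib_left mult_ac)
qed

text \<open>The heart of the argument. Here \<open>P\<close> is the marginal cost of the next covariance. Stationarity in
  \<open>K\<close> reads \<open>(R K + B\<^sup>T P (A + B K)) S = 0\<close>, and since \<open>S\<close> is nonsingular,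
  \<open>H K = - B\<^sup>T P A\<close> for \<open>H = R + B\<^sup>T P B\<close>. Optimality in \<open>Q\<close> gives that \<open>H\<close> is positive semidefinite and
  \<open>tr (H Q) \<le> 0\<close>. If \<open>H z = 0\<close>, transposing the first relation gives \<open>A\<^sup>T P B z = 0\<close>, hence \<open>P B z = 0\<close> as
  \<open>A\<close> is nonsingular, hence \<open>R z = H z - B\<^sup>T P B z = 0\<close> and \<open>z = 0\<close>. So \<open>H\<close> is positive definite, and
  \<open>tr (H Q) \<le> 0\<close> leaves only \<open>Q = 0\<close>.\<close>

lemma stage_optimality_imp_no_noise:
  fixes A P S :: "real^'n^'n" and B :: "real^'m^'n" and K :: "real^'n^'m" and R Q :: "real^'m^'m"
  assumes "pd R" "pd S" "psd Q" and symP: "transpose P = P" and "invertible A" and "0 \<le> c"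
    and opt: "\<And>K' Q'. psd Q' \<Longrightarrow>
      0 \<le> stage_cost R K' Q' S - stage_cost R K Q S
           + trace (P ** (controlled_cov A B K' Q' S - controlled_cov A B K Q S))
           + c * (norm (controlled_cov A B K' Q' S - controlled_cov A B K Q S))\<^sup>2"
  shows "Q = 0"
proof -
  have symR: "transpose R = R" and symS: "transpose S = S" using assms by (auto simp: pd_def)
  define H where "H = R + transpose B ** P ** B"
  define F where "F = A + B ** K"
  define G where "G = R ** K + transpose B ** P ** F"
  have symH: "transpose H = H"
    by (simp add: H_def transpose_add symR symP matrix_transpose_mul matrix_mul_assoc)

  \<comment> \<open>\<open>H\<close> is the gradient of the objective with respect to \<open>Q\<close>, and \<open>2 G S\<close> the one with respect
    to \<open>K\<close>.\<close>
  have noise_direction: "0 \<le> trace (H ** E)"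
    if E: "\<And>t. 0 < t \<Longrightarrow> t \<le> 1 \<Longrightarrow> psd (Q + t *\<^sub>R E)" for E
  proof (rule quadratic_nonneg_imp_slope_nonneg)
    fix t :: real assume t: "0 < t" "t \<le> 1"
    have eq: "controlled_cov A B K (Q + t *\<^sub>R E) S - controlled_cov A B K Q S
        = t *\<^sub>R (B ** E ** transpose B)"
      by (simp add: controlled_cov_def mm.add_left mm.add_right mm.scaleR_left mm.scaleR_right)
    from opt[OF E[OF t], of K, unfolded eq stage_cost_def]
    have "0 \<le> t * trace (R ** E) + t * trace (P ** (B ** E ** transpose B))
        + c * (norm (t *\<^sub>R (B ** E ** transpose B)))\<^sup>2"
      by (simp add: mm.add_right mm.scaleR_right trace_add trace_scaleR)
    moreover have "trace (P ** (B ** E ** transpose B)) = trace (transpose B ** P ** B ** E)"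
      by (metis matrix_mul_assoc trace_mul_sym)
    ultimately show "0 \<le> trace (H ** E) * t + (c * (norm (B ** E ** transpose B))\<^sup>2) * t\<^sup>2"
      by (simp add: H_def mm.add_left trace_add power_mult_distrib algebra_simps)
  qed

  have "0 \<le> z \<bullet> (H *v z)" for z
    unfolding trace_rank_one(2)[symmetric]
    by (intro noise_direction psd_add psd_scaleR trace_rank_one(1) assms(3)) simp
  then have psdH: "psd H" using symH by (simp add: psd_def)

  \<comment> \<open>Scaling the noise down is always admissible.\<close>
  have "psd (Q + t *\<^sub>R (- Q))" if "0 < t" "t \<le> 1" for t
    using psd_scaleR[OF assms(3), of "1 - t"] that by (simp add: scaleR_diff_left)
  from noise_direction[OF this] have HQ: "trace (H ** Q) \<le> 0"
    by (simp add: mm.minus_right trace_uminus)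

  \<comment> \<open>Along \<open>K - t G\<close> the objective has this slope, which is negative unless \<open>G\<close> vanishes.\<close>
  have "0 \<le> - 2 * trace (G ** S ** transpose G)"
  proof (rule quadratic_nonneg_imp_slope_nonneg)
    fix t :: real assume t: "0 < t" "t \<le> 1"
    define K' where "K' = K + t *\<^sub>R (- G)"
    define X where "X = - (F ** S ** transpose (B ** G) + B ** G ** S ** transpose F)"
    define Y where "Y = B ** G ** S ** transpose (B ** G)"
    define Z where "Z = t *\<^sub>R X + t\<^sup>2 *\<^sub>R Y"
    have AK': "A + B ** K' = F - t *\<^sub>R (B ** G)"
      by (simp add: K'_def F_def mm.add_right mm.minus_right mm.scaleR_right mm.diff_right)
    have Z: "controlled_cov A B K' Q S - controlled_cov A B K Q S = Z"
      unfolding controlled_cov_def AK' F_def[symmetric] Z_def X_def Y_def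
      by (simp add: transpose_diff transpose_scalar mm.diff_left mm.diff_right mm.scaleR_left
          mm.scaleR_right power2_eq_square algebra_simps)
    have ctl: "K' ** S ** transpose K' = K ** S ** transpose K
        - t *\<^sub>R (K ** S ** transpose G + G ** S ** transpose K) + t\<^sup>2 *\<^sub>R (G ** S ** transpose G)"
      by (simp add: K'_def transpose_diff transpose_scalar mm.diff_left mm.diff_right mm.scaleR_left
          mm.scaleR_right power2_eq_square algebra_simps)
    have "trace (R ** (G ** S ** transpose K)) = trace (transpose (R ** (G ** S ** transpose K)))"
      by (simp add: trace_transpose)
    also have "\<dots> = trace (R ** (K ** S ** transpose G))"
      by (simp add: matrix_transpose_mul symR symS) (metis matrix_mul_assoc trace_mul_sym)
    finally have lin1: "trace (R ** (K ** S ** transpose G + G ** S ** transpose K))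
        = 2 * trace (R ** K ** S ** transpose G)"
      by (simp add: mm.add_right trace_add matrix_mul_assoc)
    have "trace (P ** (B ** G ** S ** transpose F)) = trace (transpose (P ** (B ** G ** S ** transpose F)))"
      by (simp add: trace_transpose)
    also have "\<dots> = trace (P ** (F ** S ** transpose (B ** G)))"
      by (simp add: matrix_transpose_mul symP symS) (metis matrix_mul_assoc trace_mul_sym)
    finally have "trace (P ** X) = - 2 * trace (P ** (F ** S ** transpose (B ** G)))"
      by (simp add: X_def mm.add_right mm.minus_right mm.diff_right trace_add trace_sub trace_uminus)
    also have "trace (P ** (F ** S ** transpose (B ** G))) = trace (transpose B ** P ** F ** S ** transpose G)"
      by (simp add: matrix_transpose_mul) (metis matrix_mul_assoc trace_mul_sym)
    finally have lin2: "trace (P ** X) = - 2 * trace (transpose B ** P ** F ** S ** transpose G)" .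
    have "norm Z \<le> t * norm X + t\<^sup>2 * norm Y"
      unfolding Z_def using t by (intro order_trans[OF norm_triangle_ineq]) simp
    also have "\<dots> \<le> t * (norm X + norm Y)"
      using t by (simp add: power2_eq_square algebra_simps mult_left_le_one_le mult_left_mono)
    finally have "(norm Z)\<^sup>2 \<le> (t * (norm X + norm Y))\<^sup>2" by (intro power_mono) auto
    then have nZ: "c * (norm Z)\<^sup>2 \<le> c * (t * (norm X + norm Y))\<^sup>2"
      using \<open>0 \<le> c\<close> by (rule mult_left_mono)
    have cost: "trace (R ** (K' ** S ** transpose K' + Q)) - trace (R ** (K ** S ** transpose K + Q))
        = - t * (2 * trace (R ** K ** S ** transpose G)) + t\<^sup>2 * trace (R ** (G ** S ** transpose G))"
      unfolding ctl lin1[symmetric]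
      by (simp add: mm.add_right mm.diff_right mm.scaleR_right trace_add trace_sub trace_scaleR)
    have future: "trace (P ** Z) = t * trace (P ** X) + t\<^sup>2 * trace (P ** Y)"
      by (simp add: Z_def mm.add_right mm.scaleR_right trace_add trace_scaleR)
    have slope: "trace (G ** S ** transpose G)
        = trace (R ** K ** S ** transpose G) + trace (transpose B ** P ** F ** S ** transpose G)"
      by (subst G_def) (simp add: mm.add_left trace_add)
    have "0 \<le> - t * (2 * trace (R ** K ** S ** transpose G))
        + t\<^sup>2 * trace (R ** (G ** S ** transpose G))
        + (t * (- 2 * trace (transpose B ** P ** F ** S ** transpose G)) + t\<^sup>2 * trace (P ** Y))
        + c * (t * (norm X + norm Y))\<^sup>2"
      using opt[OF assms(3), of K'] nZ unfolding Z stage_cost_def cost future lin2 by linarith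
    also have "\<dots> = - 2 * trace (G ** S ** transpose G) * t
        + (trace (R ** (G ** S ** transpose G)) + trace (P ** Y) + c * (norm X + norm Y)\<^sup>2) * t\<^sup>2"
      unfolding slope by algebra
    finally show "0 \<le> - 2 * trace (G ** S ** transpose G) * t
        + (trace (R ** (G ** S ** transpose G)) + trace (P ** Y) + c * (norm X + norm Y)\<^sup>2) * t\<^sup>2" .
  qed
  then have "G = 0"
    using trace_congruence_pd_eq_0[OF assms(2), of G] by simp
  have "transpose G = transpose K ** H + transpose A ** P ** B"
    by (simp add: G_def F_def H_def transpose_add matrix_transpose_mul symR symP mm.add_left
        mm.add_right matrix_mul_assoc)
  with \<open>G = 0\<close> have KH: "transpose K ** H + transpose A ** P ** B = 0"
    by (simp add: transpose_zero)

  have "z = 0" if "z \<bullet> (H *v z) = 0" for z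
  proof -
    have Hz: "H *v z = 0" using psd_kernel[OF psdH that] .
    have "(transpose K ** H + transpose A ** P ** B) *v z = 0" by (simp add: KH)
    then have "transpose A *v (P *v (B *v z)) = 0"
      using Hz by (simp add: matrix_vector_mult_add_rdistrib flip: matrix_vector_mul_assoc)
    then have "P *v (B *v z) = 0"
      using \<open>invertible A\<close> transpose_invertible[OF \<open>invertible A\<close>]
      by (metis invertible_def matrix_left_invertible_ker)
    then have "R *v z = 0"
      using Hz by (simp add: H_def matrix_vector_mult_add_rdistrib flip: matrix_vector_mul_assoc)
    then show "z = 0" using \<open>pd R\<close> by (metis pd_def inner_zero_right less_irrefl)
  qed
  then have "pd H" using psdH unfolding pd_def psd_def by (metis order_le_less)
  then show ?thesis using trace_mult_pd_psd_eq_0 assms(3) HQ by blast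
qed

section \<open>Propagating a perturbation through the later stages\<close>

text \<open>Stages are numbered forwards in time, whereas the costate is determined by its terminal value.\<close>

lemma backward_recursion_exists:
  fixes h :: "nat \<Rightarrow> 'a \<Rightarrow> 'a"
  shows "\<exists>P. P N = X \<and> (\<forall>k<N. P k = h k (P (Suc k)))"
proof (induction N arbitrary: X)
  case 0
  then show ?case by (intro exI[of _ "\<lambda>_. X"]) simp
next
  case (Suc N)
  obtain P where "P N = h N X" "\<forall>k<N. P k = h k (P (Suc k))"
    using Suc.IH by blast
  then show ?case
    by (intro exI[of _ "P(Suc N := X)"]) (auto simp: less_Suc_eq)
qed

lemma costate_symmetric:
  assumes P: "\<And>j. j < N \<Longrightarrow>
      P j = transpose (F j) ** P (Suc j) ** F j + transpose (K j) ** R j ** (K j :: real^'n^'m)"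
    and R: "\<And>j. j < N \<Longrightarrow> transpose (R j) = R j" and "transpose (P N) = P N" and "i \<le> N"
  shows "transpose (P i) = (P i :: real^'n^'n)"
  using \<open>i \<le> N\<close>
proof (induction rule: inc_induct)
  case (step j)
  then show ?case
    by (simp add: P R transpose_add matrix_transpose_mul matrix_mul_assoc)
qed fact

text \<open>The costate \<open>P\<close> is the adjoint of the linear evolution of a covariance perturbation \<open>D\<close>: it
  prices a perturbation at stage \<open>i\<close> by its total effect on the later control costs and on the
  linearised terminal cost \<open>tr (P N D N)\<close>.\<close>

lemma costate_value:
  assumes P: "\<And>j. j < N \<Longrightarrow>
      P j = transpose (F j) ** P (Suc j) ** F j + transpose (K j) ** R j ** (K j :: real^'n^'m)"
    and D: "\<And>j. i \<le> j \<Longrightarrow> j < N \<Longrightarrow> D (Suc j) = F j ** D j ** transpose (F j)"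
    and "i \<le> N"
  shows "(\<Sum>j=i..<N. trace (R j ** (K j ** D j ** transpose (K j)))) + trace (P N ** D N)
    = trace (P i ** (D i :: real^'n^'n))"
  using \<open>i \<le> N\<close> D
proof (induction rule: inc_induct)
  case (step j)
  have "trace (P j ** D j) = trace (transpose (F j) ** P (Suc j) ** F j ** D j)
      + trace (transpose (K j) ** R j ** K j ** D j)"
    using step.hyps by (simp add: P mm.add_left trace_add)
  moreover have "trace (transpose (F j) ** P (Suc j) ** F j ** D j) = trace (P (Suc j) ** D (Suc j))"
  proof -
    have "D (Suc j) = F j ** D j ** transpose (F j)" using step by blast
    then show ?thesis by (metis matrix_mul_assoc trace_mul_sym)
  qed
  moreover have "trace (transpose (K j) ** R j ** K j ** D j) = trace (R j ** (K j ** D j ** transpose (K j)))"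
    by (metis matrix_mul_assoc trace_mul_sym)
  moreover have "(\<Sum>j=Suc j..<N. trace (R j ** (K j ** D j ** transpose (K j)))) + trace (P N ** D N)
      = trace (P (Suc j) ** D (Suc j))"
    by (rule step.IH) (use step.prems in auto)
  ultimately show ?case using step.hyps by (simp add: sum.atLeast_Suc_lessThan)
qed simp

text \<open>The bound has to be uniform in \<open>D\<close>, so that the quadratic error at the terminal stage is controlled
  by one constant for all perturbations at an earlier stage.\<close>

lemma iterated_congruence_bounded:
  fixes F :: "nat \<Rightarrow> real^'n^'n"
  assumes "i \<le> N"
  obtains b where "0 \<le> b"
    "\<And>D. (\<And>j. i \<le> j \<Longrightarrow> j < N \<Longrightarrow> D (Suc j) = F j ** D j ** transpose (F j)) \<Longrightarrow> norm (D N) \<le> b * norm (D i)"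
proof -
  have "\<exists>b\<ge>0. \<forall>D. (\<forall>j. i \<le> j \<longrightarrow> j < N \<longrightarrow> D (Suc j) = F j ** D j ** transpose (F j)) \<longrightarrow>
      norm (D N) \<le> b * norm (D i)"
    using assms
  proof (induction rule: dec_induct)
    case base
    then show ?case by (intro exI[of _ 1]) auto
  next
    case (step n)
    then obtain b where b: "0 \<le> b" "\<And>D. (\<forall>j. i \<le> j \<longrightarrow> j < n \<longrightarrow> D (Suc j) = F j ** D j ** transpose (F j))
      \<Longrightarrow> norm (D n) \<le> b * norm (D i)" by blast
    obtain a where a: "0 \<le> a" "\<And>X. norm (F n ** X ** transpose (F n)) \<le> a * norm X"
      using norm_congruence_bounded by blast
    show ?case
    proof (intro exI[of _ "a * b"] conjI allI impI)
      fix D assume D: "\<forall>j. i \<le> j \<longrightarrow> j < Suc n \<longrightarrow> D (Suc j) = F j ** D j ** transpose (F j)"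
      then have "norm (D n) \<le> b * norm (D i)" by (intro b(2)) simp
      then have "a * norm (D n) \<le> a * (b * norm (D i))" using a(1) by (rule mult_left_mono)
      then show "norm (D (Suc n)) \<le> a * b * norm (D i)"
        using D a(2)[of "D n"] step.hyps by simp
    qed (use a b in simp)
  qed
  then show ?thesis using that by blast
qed

primrec covariances ::
    "(nat \<Rightarrow> real^'n^'n) \<Rightarrow> (nat \<Rightarrow> real^'m^'n) \<Rightarrow> (nat \<Rightarrow> real^'n^'n) \<Rightarrow> real^'n^'n \<Rightarrow>
     (nat \<Rightarrow> real^'n^'m) \<Rightarrow> (nat \<Rightarrow> real^'m^'m) \<Rightarrow> nat \<Rightarrow> real^'n^'n"
where
  "covariances A B W S0 K Q 0 = S0"
| "covariances A B W S0 K Q (Suc k) =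
     controlled_cov (A k) (B k) (K k) (Q k) (covariances A B W S0 K Q k) + W k"

lemma psd_covariances:
  assumes "psd S0" "\<And>j. j < N \<Longrightarrow> psd (W j)" "\<And>j. j < N \<Longrightarrow> psd (Q j)" "i \<le> N"
  shows "psd (covariances A B W S0 K Q i)"
  using \<open>i \<le> N\<close>
  by (induction i) (auto simp: controlled_cov_def intro!: psd_add psd_congruence assms)

lemma nlp_feasible_covariances:
  "nlp_feasible N \<mu>0 S0 A B W v K Q \<mu> S \<Longrightarrow> i \<le> N \<Longrightarrow> S i = covariances A B W S0 K Q i"
  by (induction i) (auto simp: nlp_feasible_def controlled_cov_def)

text \<open>Compare the solution with the policy that uses \<open>K', Q'\<close> at stage \<open>k\<close> and the same parameters
  elsewhere. From stage \<open>k + 1\<close> on, the covariances differ by a perturbation that evolves linearly, so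
  the costate reduces the change of the objective to stage \<open>k\<close>. The terminal cost is not linear, but
  the lower bound for the trace of the square root linearises it up to the quadratic term.\<close>

lemma nlp_stage_optimality:
  fixes A :: "nat \<Rightarrow> real^'n^'n" and B :: "nat \<Rightarrow> real^'m^'n"
  assumes sol: "nlp_solution N lam \<mu>0 S0 \<mu>d Sd A B W R v K Q \<mu> S"
    and "pd (S N)" "pd Sd" "0 < lam" "psd S0"
    and W: "\<And>k. k < N \<Longrightarrow> psd (W k)" and R: "\<And>k. k < N \<Longrightarrow> transpose (R k) = R k"
    and "k < N"
  obtains P c where "transpose P = P" "0 \<le> c"
    "\<And>K' Q'. psd Q' \<Longrightarrow>
      0 \<le> stage_cost (R k) K' Q' (S k) - stage_cost (R k) (K k) (Q k) (S k)
           + trace (P ** (controlled_cov (A k) (B k) K' Q' (S k)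
                          - controlled_cov (A k) (B k) (K k) (Q k) (S k)))
           + c * (norm (controlled_cov (A k) (B k) K' Q' (S k)
                        - controlled_cov (A k) (B k) (K k) (Q k) (S k)))\<^sup>2"
proof -
  have feas: "nlp_feasible N \<mu>0 S0 A B W v K Q \<mu> S"
    and opt: "\<And>v' K' Q' \<mu>' S'. nlp_feasible N \<mu>0 S0 A B W v' K' Q' \<mu>' S' \<Longrightarrow>
        nlp_objective N lam \<mu>d Sd R v K Q \<mu> S \<le> nlp_objective N lam \<mu>d Sd R v' K' Q' \<mu>' S'"
    using sol by (auto simp: nlp_solution_def)
  have psdQ: "\<And>j. j < N \<Longrightarrow> psd (Q j)" using feas by (simp add: nlp_feasible_def)
  have Seq: "S i = covariances A B W S0 K Q i" if "i \<le> N" for i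
    using nlp_feasible_covariances[OF feas that] .
  define L where "L = psd_sqrt Sd"
  obtain G c where symG: "transpose G = G" and c: "0 \<le> c"
    and G: "\<And>S'. psd S' \<Longrightarrow> trace (psd_sqrt (L ** S N ** L)) + trace (G ** (S' - S N)) / 2
        - c * (norm (S' - S N))\<^sup>2 \<le> trace (psd_sqrt (L ** S' ** L))"
    using trace_psd_sqrt_congruence_lower_bound[OF pd_psd_sqrt[OF \<open>pd Sd\<close>] \<open>pd (S N)\<close>, folded L_def]
    by blast
  define F where "F = (\<lambda>j. A j + B j ** K j)"
  define X where "X = lam *\<^sub>R (mat 1 - G)"
  obtain P where PN: "P N = X"
    and P: "\<And>j. j < N \<Longrightarrow> P j = transpose (F j) ** P (Suc j) ** F j + transpose (K j) ** R j ** K j"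
    using backward_recursion_exists[of N X "\<lambda>j Y. transpose (F j) ** Y ** F j + transpose (K j) ** R j ** K j"]
    by blast
  have "transpose (P N) = P N"
    unfolding PN X_def by (simp add: transpose_scalar transpose_diff symG)
  from costate_symmetric[OF P R this] have "transpose (P (Suc k)) = P (Suc k)"
    using \<open>k < N\<close> by simp
  moreover obtain b where b: "0 \<le> b"
      "\<And>D. (\<And>j. Suc k \<le> j \<Longrightarrow> j < N \<Longrightarrow> D (Suc j) = F j ** D j ** transpose (F j))
      \<Longrightarrow> norm (D N) \<le> b * norm (D (Suc k))"
    using iterated_congruence_bounded[of "Suc k" N F] \<open>k < N\<close> by (metis Suc_leI)
  moreover have "0 \<le> stage_cost (R k) K' Q' (S k) - stage_cost (R k) (K k) (Q k) (S k)
           + trace (P (Suc k) ** (controlled_cov (A k) (B k) K' Q' (S k)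
                          - controlled_cov (A k) (B k) (K k) (Q k) (S k)))
           + (2 * lam * c * b\<^sup>2) * (norm (controlled_cov (A k) (B k) K' Q' (S k)
                        - controlled_cov (A k) (B k) (K k) (Q k) (S k)))\<^sup>2"
    if "psd Q'" for K' Q'
  proof -
    define \<Delta> where "\<Delta> = controlled_cov (A k) (B k) K' Q' (S k)
                        - controlled_cov (A k) (B k) (K k) (Q k) (S k)"
    define K2 Q2 where "K2 = K(k := K')" and "Q2 = Q(k := Q')"
    define S2 where "S2 = covariances A B W S0 K2 Q2"
    define D where "D = (\<lambda>j. S2 j - S j)"
    have psdQ2: "psd (Q2 j)" if "j < N" for j
      using psdQ that \<open>psd Q'\<close> by (simp add: Q2_def)
    have psdS2: "psd (S2 j)" if "j \<le> N" for j
      unfolding S2_def using psd_covariances[OF \<open>psd S0\<close> W psdQ2 that] .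
    have "nlp_feasible N \<mu>0 S0 A B W v K2 Q2 \<mu> S2"
      using feas psdQ2 psdS2 by (simp add: nlp_feasible_def S2_def controlled_cov_def)
    from opt[OF this] have le: "0 \<le> (\<Sum>j<N. stage_cost (R j) (K2 j) (Q2 j) (S2 j)
              - stage_cost (R j) (K j) (Q j) (S j))
        + lam * (trace (D N) - 2 * (trace (psd_sqrt (L ** S2 N ** L)) - trace (psd_sqrt (L ** S N ** L))))"
      by (simp add: nlp_objective_def stage_cost_def sum.distrib sum_subtractf trace_add
          trace_sub D_def L_def algebra_simps)
    have same: "S2 j = S j" if "j \<le> k" for j
    proof -
      have "covariances A B W S0 K2 Q2 j = covariances A B W S0 K Q j"
        using that by (induction j) (simp_all add: K2_def Q2_def)
      then show ?thesis using that \<open>k < N\<close> by (simp add: S2_def Seq)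
    qed
    have Sstep: "S (Suc j) = F j ** S j ** transpose (F j) + B j ** Q j ** transpose (B j) + W j"
      if "j < N" for j
      using that feas by (simp add: nlp_feasible_def F_def)
    have D0: "D (Suc k) = \<Delta>"
      using same[of k] \<open>k < N\<close>
      by (simp add: D_def Sstep \<Delta>_def F_def) (simp add: S2_def K2_def Q2_def controlled_cov_def)
    have Dstep: "D (Suc j) = F j ** D j ** transpose (F j)" if "Suc k \<le> j" "j < N" for j
      using that by (simp add: D_def Sstep mm.diff_left mm.diff_right)
        (simp add: S2_def K2_def Q2_def F_def controlled_cov_def)
    \<comment> \<open>Only the stages from \<open>k\<close> on contribute to the change of the control cost.\<close>
    have "(\<Sum>j<N. stage_cost (R j) (K2 j) (Q2 j) (S2 j)
              - stage_cost (R j) (K j) (Q j) (S j))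
       = (\<Sum>j=k..<N. stage_cost (R j) (K2 j) (Q2 j) (S2 j)
              - stage_cost (R j) (K j) (Q j) (S j))"
      using same by (intro sum.mono_neutral_right) (auto simp: K2_def Q2_def)
    also have "\<dots> = stage_cost (R k) K' Q' (S k) - stage_cost (R k) (K k) (Q k) (S k)
       + (\<Sum>j=Suc k..<N. stage_cost (R j) (K2 j) (Q2 j) (S2 j)
              - stage_cost (R j) (K j) (Q j) (S j))"
      using \<open>k < N\<close> same[of k] by (simp add: sum.atLeast_Suc_lessThan K2_def Q2_def)
    also have "(\<Sum>j=Suc k..<N. stage_cost (R j) (K2 j) (Q2 j) (S2 j)
              - stage_cost (R j) (K j) (Q j) (S j))
       = (\<Sum>j=Suc k..<N. trace (R j ** (K j ** D j ** transpose (K j))))"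
      by (intro sum.cong refl)
        (simp add: K2_def Q2_def D_def stage_cost_def mm.add_right mm.diff_left mm.diff_right
            trace_sub trace_add)
    finally have change: "(\<Sum>j<N. stage_cost (R j) (K2 j) (Q2 j) (S2 j)
              - stage_cost (R j) (K j) (Q j) (S j))
       = stage_cost (R k) K' Q' (S k) - stage_cost (R k) (K k) (Q k) (S k)
       + (\<Sum>j=Suc k..<N. trace (R j ** (K j ** D j ** transpose (K j))))" .
    have "norm (D N) \<le> b * norm \<Delta>" using b(2)[of D, OF Dstep] D0 by simp
    then have "c * (norm (D N))\<^sup>2 \<le> c * (b * norm \<Delta>)\<^sup>2"
      using c by (intro mult_left_mono power_mono) auto
    then have "trace (D N) - 2 * (trace (psd_sqrt (L ** S2 N ** L)) - trace (psd_sqrt (L ** S N ** L)))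
        \<le> trace (D N) - trace (G ** D N) + 2 * (c * (b * norm \<Delta>)\<^sup>2)"
      using G[OF psdS2[of N], folded D_def] by (simp add: D_def)
    then have "lam * (trace (D N) - 2 * (trace (psd_sqrt (L ** S2 N ** L)) - trace (psd_sqrt (L ** S N ** L))))
        \<le> lam * (trace (D N) - trace (G ** D N) + 2 * (c * (b * norm \<Delta>)\<^sup>2))"
      using \<open>0 < lam\<close> by (intro mult_left_mono) auto
    also have "\<dots> = trace (P N ** D N) + (2 * lam * c * b\<^sup>2) * (norm \<Delta>)\<^sup>2"
      by (simp add: PN X_def mm.scaleR_left mm.diff_left trace_scaleR trace_sub power_mult_distrib
          distrib_left)
    finally have terminal:
      "lam * (trace (D N) - 2 * (trace (psd_sqrt (L ** S2 N ** L)) - trace (psd_sqrt (L ** S N ** L))))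
        \<le> trace (P N ** D N) + (2 * lam * c * b\<^sup>2) * (norm \<Delta>)\<^sup>2" .
    have "(\<Sum>j=Suc k..<N. trace (R j ** (K j ** D j ** transpose (K j)))) + trace (P N ** D N)
        = trace (P (Suc k) ** D (Suc k))"
      using \<open>k < N\<close> by (intro costate_value[where F = F] P Dstep) auto
    then show ?thesis using le terminal unfolding change D0 \<Delta>_def[symmetric] by linarith
  qed
  moreover have "0 \<le> 2 * lam * c * b\<^sup>2" using c \<open>0 < lam\<close> by simp
  ultimately show ?thesis using that by blast
qed

section \<open>Degenerate directions of Gaussian and square-integrable vectors\<close>

text \<open>Quantifying over all directions \<open>a\<close>, and not only over coordinates, makes closure under linear
  maps immediate and matches the definition of Gaussian vectors.\<close>

definition square_integrable_vector :: "'a measure \<Rightarrow> ('a \<Rightarrow> real^'n) \<Rightarrow> bool" where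
  "square_integrable_vector M X \<longleftrightarrow>
     X \<in> borel_measurable M \<and> (\<forall>a. integrable M (\<lambda>\<omega>. (a \<bullet> X \<omega>)\<^sup>2))"

lemma integrable_square_normal_law:
  assumes "0 \<le> s"
  shows "integrable (normal_law m s) (\<lambda>x. x\<^sup>2)"
proof (cases "s = 0")
  case True
  have "integrable (return borel m) (\<lambda>x::real. x\<^sup>2)"
    by (intro integrableI_bounded) (simp_all add: nn_integral_return)
  then show ?thesis using True by (simp add: normal_law_def)
next
  case False
  then have "0 < sqrt s" using assms by simp
  have "integrable lborel (\<lambda>x. normal_density m (sqrt s) x * (x - m)^2
      + 2 * m * (normal_density m (sqrt s) x * (x - m)^1) + m\<^sup>2 * normal_density m (sqrt s) x)"
    using \<open>0 < sqrt s\<close>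
    by (intro Bochner_Integration.integrable_add integrable_mult_right integrable_normal_moment
        integrable_normal_density)
  also have "(\<lambda>x. normal_density m (sqrt s) x * (x - m)^2
      + 2 * m * (normal_density m (sqrt s) x * (x - m)^1) + m\<^sup>2 * normal_density m (sqrt s) x)
    = (\<lambda>x. normal_density m (sqrt s) x *\<^sub>R x\<^sup>2)"
    by (rule ext) (simp add: power2_eq_square algebra_simps)
  finally show ?thesis
    using False by (simp add: normal_law_def integrable_density)
qed

lemma gaussian_vector_square_integrable:
  assumes "gaussian_vector M m S X" "psd S"
  shows "square_integrable_vector M X"
  unfolding square_integrable_vector_def
proof (intro conjI allI)
  show X: "X \<in> borel_measurable M" using assms(1) by (simp add: gaussian_vector_def)
  fix a
  have "integrable (distr M borel (\<lambda>\<omega>. a \<bullet> X \<omega>)) (\<lambda>x. x\<^sup>2)"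
    using assms by (simp add: gaussian_vector_def integrable_square_normal_law psd_nonneg)
  then show "integrable M (\<lambda>\<omega>. (a \<bullet> X \<omega>)\<^sup>2)"
    using X by (subst (asm) integrable_distr_eq) auto
qed

lemma gaussian_vector_degenerate_direction:
  assumes "gaussian_vector M m S X" "a \<bullet> (S *v a) = 0"
  shows "AE \<omega> in M. a \<bullet> X \<omega> = a \<bullet> m"
proof -
  have X: "X \<in> borel_measurable M" using assms(1) by (simp add: gaussian_vector_def)
  have eq: "distr M borel (\<lambda>\<omega>. a \<bullet> X \<omega>) = return borel (a \<bullet> m)"
    using assms by (simp add: gaussian_vector_def normal_law_def)
  have "AE x in distr M borel (\<lambda>\<omega>. a \<bullet> X \<omega>). x = a \<bullet> m"
    unfolding eq by (simp add: AE_return)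
  then show ?thesis using X by (subst (asm) AE_distr_iff) auto
qed

context prob_space
begin

lemma square_integrable_vector_const: "square_integrable_vector M (\<lambda>_. c)"
  by (simp add: square_integrable_vector_def)

lemma square_integrable_vector_add:
  assumes "square_integrable_vector M X" "square_integrable_vector M Y"
  shows "square_integrable_vector M (\<lambda>\<omega>. X \<omega> + Y \<omega>)"
  unfolding square_integrable_vector_def
proof (intro conjI allI)
  show meas: "(\<lambda>\<omega>. X \<omega> + Y \<omega>) \<in> borel_measurable M"
    using assms by (intro borel_measurable_add) (auto simp: square_integrable_vector_def)
  fix a
  show "integrable M (\<lambda>\<omega>. (a \<bullet> (X \<omega> + Y \<omega>))\<^sup>2)"
  proof (rule Bochner_Integration.integrable_bound)
    show "integrable M (\<lambda>\<omega>. 2 * (a \<bullet> X \<omega>)\<^sup>2 + 2 * (a \<bullet> Y \<omega>)\<^sup>2)"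
      using assms by (simp add: square_integrable_vector_def)
    have "(p + q)\<^sup>2 \<le> 2 * p\<^sup>2 + 2 * q\<^sup>2" for p q :: real
      using zero_le_power2[of "p - q"] by (simp add: power2_eq_square algebra_simps)
    then show "AE \<omega> in M. norm ((a \<bullet> (X \<omega> + Y \<omega>))\<^sup>2) \<le> norm (2 * (a \<bullet> X \<omega>)\<^sup>2 + 2 * (a \<bullet> Y \<omega>)\<^sup>2)"
      by (simp add: inner_add_right)
  qed (use meas in simp)
qed

lemma square_integrable_vector_matrix:
  assumes "square_integrable_vector M X"
  shows "square_integrable_vector M (\<lambda>\<omega>. F *v X \<omega>)"
  unfolding square_integrable_vector_def
proof (intro conjI allI)
  have X: "X \<in> borel_measurable M" using assms by (simp add: square_integrable_vector_def)
  show "(\<lambda>\<omega>. F *v X \<omega>) \<in> borel_measurable M"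
    by (rule measurable_compose[OF X])
      (intro borel_measurable_continuous_onI linear_continuous_on matrix_vector_mul_bounded_linear)
  show "integrable M (\<lambda>\<omega>. (a \<bullet> (F *v X \<omega>))\<^sup>2)" for a
    using assms unfolding square_integrable_vector_def inner_transpose_left[symmetric] by simp
qed

lemma square_integrable_vector_integrable:
  assumes "square_integrable_vector M X"
  shows "integrable M X"
proof -
  have X: "X \<in> borel_measurable M" using assms by (simp add: square_integrable_vector_def)
  have "integrable M (\<lambda>\<omega>. X \<omega> \<bullet> a)" for a
  proof (rule Bochner_Integration.integrable_bound)
    show "integrable M (\<lambda>\<omega>. 1 + (a \<bullet> X \<omega>)\<^sup>2)"
      using assms by (simp add: square_integrable_vector_def)
    have "\<bar>p\<bar> \<le> 1 + p\<^sup>2" for p :: real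
      using zero_le_power2[of "\<bar>p\<bar> - 1"] zero_le_power2[of p]
      by (simp add: power2_eq_square algebra_simps del: zero_le_power2)
    then show "AE \<omega> in M. norm (X \<omega> \<bullet> a) \<le> norm (1 + (a \<bullet> X \<omega>)\<^sup>2)"
      by (simp add: inner_commute)
  qed (use X in simp)
  then have "integrable M (\<lambda>\<omega>. \<Sum>b\<in>Basis. (X \<omega> \<bullet> b) *\<^sub>R b)" by simp
  then show ?thesis by (simp add: euclidean_representation)
qed

text \<open>Row \<open>i\<close> of the product is the covariance of the coordinate \<open>i\<close> with \<open>a \<bullet> X\<close>. Square integrability
  matters because the Bochner integral of a non-integrable function is zero by convention.\<close>

lemma cov_kernel_of_almost_sure_constant:
  assumes X: "square_integrable_vector M X" and const: "AE \<omega> in M. a \<bullet> X \<omega> = c"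
  shows "cov M X *v a = 0"
proof -
  define Y where "Y = (\<lambda>\<omega>. X \<omega> - mean M X)"
  have "square_integrable_vector M Y"
    using square_integrable_vector_add[OF X square_integrable_vector_const[of "- mean M X"]]
    by (simp add: Y_def)
  then have Ymeas[measurable]: "Y \<in> borel_measurable M" and sq: "\<And>b. integrable M (\<lambda>\<omega>. (b \<bullet> Y \<omega>)\<^sup>2)"
    by (auto simp: square_integrable_vector_def)
  have sqi: "integrable M (\<lambda>\<omega>. (Y \<omega> $ i)\<^sup>2)" for i
    using sq[of "axis i 1"] by (simp add: inner_axis')
  have [measurable]: "(\<lambda>\<omega>. Y \<omega> $ i) \<in> borel_measurable M" for i
    by (rule measurable_compose[OF Ymeas]) (intro borel_measurable_continuous_onI continuous_intros)
  have prod: "integrable M (\<lambda>\<omega>. Y \<omega> $ i * Y \<omega> $ j)" for i j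
  proof (rule Bochner_Integration.integrable_bound)
    show "integrable M (\<lambda>\<omega>. (Y \<omega> $ i)\<^sup>2 + (Y \<omega> $ j)\<^sup>2)" using sqi by simp
    have "\<bar>p * q\<bar> \<le> p\<^sup>2 + q\<^sup>2" for p q :: real
      using sum_squares_bound[of "\<bar>p\<bar>" "\<bar>q\<bar>"] abs_ge_zero[of "p * q"]
      unfolding abs_mult power2_abs by linarith
    then show "AE \<omega> in M. norm (Y \<omega> $ i * Y \<omega> $ j) \<le> norm ((Y \<omega> $ i)\<^sup>2 + (Y \<omega> $ j)\<^sup>2)"
      by simp
  qed simp
  have "a \<bullet> mean M X = (\<integral>\<omega>. a \<bullet> X \<omega> \<partial>M)"
    unfolding mean_def using square_integrable_vector_integrable[OF X]
    by (simp add: integral_inner_right)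
  also have "\<dots> = (\<integral>\<omega>. c \<partial>M)"
    using const X by (intro integral_cong_AE) (auto simp: square_integrable_vector_def)
  finally have mean_eq: "a \<bullet> mean M X = c" by (simp add: prob_space)
  have Y0: "AE \<omega> in M. a \<bullet> Y \<omega> = 0"
    using const by eventually_elim (simp add: Y_def inner_diff_right mean_eq)
  have "(cov M X *v a) $ i = 0" for i
  proof -
    have "(cov M X *v a) $ i = (\<Sum>j\<in>UNIV. (\<integral>\<omega>. Y \<omega> $ i * Y \<omega> $ j \<partial>M) * a $ j)"
      by (simp add: matrix_vector_mult_def cov_def Y_def)
    also have "\<dots> = (\<integral>\<omega>. (\<Sum>j\<in>UNIV. Y \<omega> $ i * Y \<omega> $ j * a $ j) \<partial>M)"
      using prod by (subst Bochner_Integration.integral_sum) auto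
    also have "\<dots> = (\<integral>\<omega>. Y \<omega> $ i * (a \<bullet> Y \<omega>) \<partial>M)"
      by (intro Bochner_Integration.integral_cong refl)
        (simp add: inner_vec_def sum_distrib_left mult_ac)
    also have "\<dots> = (\<integral>\<omega>. 0 \<partial>M)"
      using Y0 by (intro integral_cong_AE) auto
    finally show ?thesis by simp
  qed
  then show ?thesis by (simp add: vec_eq_iff)
qed

end

section \<open>Nonsingularity of the state covariances\<close>

text \<open>The state process under the gains \<open>K\<close> without control noise and without feedforward term.\<close>

primrec noise_free_closed_loop ::
    "'a measure \<Rightarrow> (nat \<Rightarrow> real^'n^'n) \<Rightarrow> (nat \<Rightarrow> real^'m^'n) \<Rightarrow> (nat \<Rightarrow> real^'n^'m) \<Rightarrow>
     ('a \<Rightarrow> real^'n) \<Rightarrow> (nat \<Rightarrow> 'a \<Rightarrow> real^'n) \<Rightarrow> nat \<Rightarrow> 'a \<Rightarrow> real^'n"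
where
  "noise_free_closed_loop M A B K x0 w 0 = x0"
| "noise_free_closed_loop M A B K x0 w (Suc k) =
     (\<lambda>\<omega>. A k *v noise_free_closed_loop M A B K x0 w k \<omega>
        + B k *v (K k *v (noise_free_closed_loop M A B K x0 w k \<omega>
                          - mean M (noise_free_closed_loop M A B K x0 w k)))
        + w k \<omega>)"

lemma trajectory_noise_free_closed_loop:
  fixes M K A B x0 w
  defines "x \<equiv> noise_free_closed_loop M A B K x0 w"
  shows "trajectory M N A B x0 w (history_feedback M (\<lambda>_. 0) (\<lambda>k \<tau>. if \<tau> = k then K k else 0) x) x"
proof -
  have "(\<Sum>\<tau>\<le>k. (if \<tau> = k then K k else 0) *v (x \<tau> \<omega> - mean M (x \<tau>)))
      = K k *v (x k \<omega> - mean M (x k))" for k \<omega>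
  proof -
    have "(\<Sum>\<tau>\<le>k. (if \<tau> = k then K k else 0) *v (x \<tau> \<omega> - mean M (x \<tau>)))
      = (\<Sum>\<tau>\<le>k. if \<tau> = k then K k *v (x k \<omega> - mean M (x k)) else 0)"
      by (intro sum.cong) auto
    then show ?thesis by simp
  qed
  then show ?thesis by (simp add: trajectory_def history_feedback_def x_def)
qed

lemma (in prob_space) square_integrable_noise_free_closed_loop:
  assumes "square_integrable_vector M x0" "\<And>k. k < N \<Longrightarrow> square_integrable_vector M (w k)" "k \<le> N"
  shows "square_integrable_vector M (noise_free_closed_loop M A B K x0 w k)"
  using \<open>k \<le> N\<close>
proof (induction k)
  case (Suc k)
  let ?x = "noise_free_closed_loop M A B K x0 w k"
  have "square_integrable_vector M ?x" using Suc by simp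
  then have "square_integrable_vector M (\<lambda>\<omega>. A k *v ?x \<omega> + B k *v (K k *v (?x \<omega> + (- mean M ?x))) + w k \<omega>)"
    using Suc.prems
    by (intro square_integrable_vector_add square_integrable_vector_matrix
        square_integrable_vector_const assms) auto
  then show ?case by simp
qed (simp add: assms)

text \<open>A direction \<open>a\<close> in which the covariance at stage \<open>k + 1\<close> degenerates makes each of the three
  semidefinite summands vanish: \<open>W k\<close> degenerates in direction \<open>a\<close>, so \<open>a \<bullet> w k\<close> is almost surely zero,
  and the covariance at stage \<open>k\<close> degenerates in the direction \<open>b = (A k + B k K k)\<^sup>T a\<close>, so the induction
  hypothesis applies there.\<close>

lemma degenerate_direction_closed_loop:
  assumes x0: "gaussian_vector M \<mu>0 S0 x0" and w: "\<And>k. k < N \<Longrightarrow> gaussian_vector M 0 (W k) (w k)"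
    and S0: "psd S0" and W: "\<And>k. k < N \<Longrightarrow> psd (W k)" and Q: "\<And>k. k < N \<Longrightarrow> psd (Q k)"
    and "k \<le> N" and "a \<bullet> (covariances A B W S0 K Q k *v a) = 0"
  shows "\<exists>c. AE \<omega> in M. a \<bullet> noise_free_closed_loop M A B K x0 w k \<omega> = c"
  using assms(6,7)
proof (induction k arbitrary: a)
  case 0
  then show ?case using gaussian_vector_degenerate_direction[OF x0] by auto
next
  case (Suc k)
  let ?x = "noise_free_closed_loop M A B K x0 w k" and ?S = "covariances A B W S0 K Q k"
  define b where "b = transpose (A k + B k ** K k) *v a"
  have psdS: "psd ?S" using Suc.prems(1) by (intro psd_covariances[where N = N] S0 W Q) auto
  have k: "k < N" using Suc.prems(1) by simp
  have "b \<bullet> (?S *v b) + (transpose (B k) *v a) \<bullet> (Q k *v (transpose (B k) *v a)) + a \<bullet> (W k *v a) = 0"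
    using Suc.prems(2) by (simp add: matrix_vector_mult_add_rdistrib inner_add_right congruence_form b_def
        controlled_cov_def)
  then have "b \<bullet> (?S *v b) = 0" and Wa: "a \<bullet> (W k *v a) = 0"
    using psd_nonneg[OF psdS, of b] psd_nonneg[OF Q[OF k], of "transpose (B k) *v a"]
      psd_nonneg[OF W[OF k], of a] by linarith+
  then obtain c where c: "AE \<omega> in M. b \<bullet> ?x \<omega> = c"
    using Suc.IH[of b] Suc.prems(1) by auto
  have "AE \<omega> in M. a \<bullet> w k \<omega> = 0"
    using gaussian_vector_degenerate_direction[OF w[OF k] Wa] by simp
  with c have "AE \<omega> in M. a \<bullet> noise_free_closed_loop M A B K x0 w (Suc k) \<omega>
      = c - a \<bullet> (B k *v (K k *v mean M ?x))"
  proof eventually_elim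
    case (elim \<omega>)
    have "b \<bullet> ?x \<omega> = a \<bullet> ((A k + B k ** K k) *v ?x \<omega>)"
      unfolding b_def by (rule inner_transpose_left)
    also have "\<dots> = a \<bullet> (A k *v ?x \<omega>) + a \<bullet> (B k *v (K k *v ?x \<omega>))"
      by (simp only: matrix_vector_mult_add_rdistrib inner_add_right matrix_vector_mul_assoc)
    finally have split: "b \<bullet> ?x \<omega> = a \<bullet> (A k *v ?x \<omega>) + a \<bullet> (B k *v (K k *v ?x \<omega>))" .
    have "a \<bullet> noise_free_closed_loop M A B K x0 w (Suc k) \<omega> = a \<bullet> (A k *v ?x \<omega>)
        + (a \<bullet> (B k *v (K k *v ?x \<omega>)) - a \<bullet> (B k *v (K k *v mean M ?x))) + a \<bullet> w k \<omega>"
      by (simp only: noise_free_closed_loop.simps inner_add_right inner_diff_right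
          matrix_vector_mult_diff_distrib)
    with elim split show ?case by linarith
  qed
  then show ?case by blast
qed

text \<open>The state covariances of a randomized policy dominate those of the history feedback with the
  same gains and no control noise, which are nonsingular by hypothesis. The proof works with
  degenerate directions: one of \<open>S k\<close> would be one of the covariance of the noise-free closed loop.\<close>

lemma nlp_covariance_pd:
  assumes "prob_space M"
    and x0: "gaussian_vector M \<mu>0 S0 x0" and w: "\<And>k. k < N \<Longrightarrow> gaussian_vector M 0 (W k) (w k)"
    and S0: "psd S0" and W: "\<And>k. k < N \<Longrightarrow> psd (W k)"
    and history_pd: "\<And>v' K' x' k. trajectory M N A B x0 w (history_feedback M v' K' x') x' \<Longrightarrow>
          k \<le> N \<Longrightarrow> pd (cov M (x' k))"
    and feas: "nlp_feasible N \<mu>0 S0 A B W v K Q \<mu> S"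
    and "k \<le> N"
  shows "pd (S k)"
proof -
  interpret prob_space M by fact
  let ?x = "noise_free_closed_loop M A B K x0 w"
  have Q: "\<And>k. k < N \<Longrightarrow> psd (Q k)" and psdS: "psd (S k)"
    using feas \<open>k \<le> N\<close> by (auto simp: nlp_feasible_def)
  have "a = 0" if a: "a \<bullet> (S k *v a) = 0" for a
  proof -
    have "a \<bullet> (covariances A B W S0 K Q k *v a) = 0"
      using a nlp_feasible_covariances[OF feas \<open>k \<le> N\<close>] by simp
    then obtain c where "AE \<omega> in M. a \<bullet> ?x k \<omega> = c"
      using degenerate_direction_closed_loop[where W = W and Q = Q and w = w, OF x0 w S0 W Q \<open>k \<le> N\<close>]
      by blast
    moreover have "square_integrable_vector M (?x k)"
      using x0 w S0 W \<open>k \<le> N\<close>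
      by (intro square_integrable_noise_free_closed_loop[where N = N])
        (auto intro: gaussian_vector_square_integrable)
    ultimately have "cov M (?x k) *v a = 0"
      by (intro cov_kernel_of_almost_sure_constant)
    moreover have "pd (cov M (?x k))"
      by (rule history_pd[OF trajectory_noise_free_closed_loop \<open>k \<le> N\<close>])
    ultimately show ?thesis by (metis pd_def inner_zero_right less_irrefl)
  qed
  then show ?thesis using psdS unfolding pd_def psd_def by (metis order_le_less)
qed

theorem theorem3:
  fixes N :: nat and lam :: real
    and \<mu>0 \<mu>d :: "real^'n" and S0 Sd :: "real^'n^'n"
    and A :: "nat \<Rightarrow> real^'n^'n" and B :: "nat \<Rightarrow> real^'m^'n"
    and W :: "nat \<Rightarrow> real^'n^'n" and R :: "nat \<Rightarrow> real^'m^'m"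
    and M :: "'a measure" and x0 :: "'a \<Rightarrow> real^'n" and w :: "nat \<Rightarrow> 'a \<Rightarrow> real^'n"
    and v :: "nat \<Rightarrow> real^'m" and K :: "nat \<Rightarrow> real^'n^'m" and Q :: "nat \<Rightarrow> real^'m^'m"
    and \<nu> :: "nat \<Rightarrow> 'a \<Rightarrow> real^'m" and x :: "nat \<Rightarrow> 'a \<Rightarrow> real^'n"
  assumes "1 \<le> N" and "0 < lam" and "pd S0" and "pd Sd"
    and "\<And>k. k < N \<Longrightarrow> psd (W k)" and "\<And>k. k < N \<Longrightarrow> pd (R k)"
    and "prob_space M"
    and "gaussian_vector M \<mu>0 S0 x0"
    and "\<And>k. k < N \<Longrightarrow> gaussian_vector M 0 (W k) (w k)"
    and history_pd: "\<And>v' K' x' k. trajectory M N A B x0 w (history_feedback M v' K' x') x' \<Longrightarrow>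
          k \<le> N \<Longrightarrow> pd (cov M (x' k))"
    and "\<And>k. k < N \<Longrightarrow> invertible (A k)"
    and "\<And>k. k < N \<Longrightarrow> psd (Q k)"
    and "\<And>k. k < N \<Longrightarrow> gaussian_vector M 0 (Q k) (\<nu> k)"
    and "independent_sources M N x0 w \<nu>"
    and "trajectory M N A B x0 w (randomized_feedback M v K \<nu> x) x"
    and "nlp_solution N lam \<mu>0 S0 \<mu>d Sd A B W R v K Q (\<lambda>k. mean M (x k)) (\<lambda>k. cov M (x k))"
  shows "\<forall>k<N. Q k = 0"
proof (intro allI impI)
  fix k assume "k < N"
  note sol = \<open>nlp_solution N lam \<mu>0 S0 \<mu>d Sd A B W R v K Q (\<lambda>k. mean M (x k)) (\<lambda>k. cov M (x k))\<close>
  have feas: "nlp_feasible N \<mu>0 S0 A B W v K Q (\<lambda>k. mean M (x k)) (\<lambda>k. cov M (x k))"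
    using sol by (simp add: nlp_solution_def)
  have pd_cov: "pd (cov M (x j))" if "j \<le> N" for j
    using nlp_covariance_pd[OF \<open>prob_space M\<close> assms(8,9) pd_imp_psd[OF \<open>pd S0\<close>] assms(5) _ feas that]
      history_pd by blast
  have symR: "transpose (R j) = R j" if "j < N" for j using assms(6)[OF that] by (simp add: pd_def)
  let ?S = "cov M (x k)"
  obtain P c where "transpose P = P" "0 \<le> c"
    "\<And>K' Q'. psd Q' \<Longrightarrow>
      0 \<le> stage_cost (R k) K' Q' ?S - stage_cost (R k) (K k) (Q k) ?S
           + trace (P ** (controlled_cov (A k) (B k) K' Q' ?S
                          - controlled_cov (A k) (B k) (K k) (Q k) ?S))
           + c * (norm (controlled_cov (A k) (B k) K' Q' ?S
                        - controlled_cov (A k) (B k) (K k) (Q k) ?S))\<^sup>2"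
    using nlp_stage_optimality[OF sol pd_cov \<open>pd Sd\<close> \<open>0 < lam\<close> pd_imp_psd[OF \<open>pd S0\<close>] assms(5) symR \<open>k < N\<close>]
    by blast
  then show "Q k = 0"
    using \<open>k < N\<close> assms(6,11,12) pd_cov by (intro stage_optimality_imp_no_noise[of "R k" ?S]) auto
qed

end
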